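(* Let $\mathbb{F}$ be an algebraically closed field of characteristic zero, let $\mathcal{C}\subset\mathbb{F}^2$ be an irreducible affine plane curve, let $\overline{\mathcal{C}}\subset\mathbb{P}^2(\mathbb{F})$ be its projective closure, and let $d=\deg(\overline{\mathcal{C}})$. If there is an integer $r$ with $1\leq r\leq 4$ such that there is a point of multiplicity $d-r$ of $\overline{\mathcal{C}}$ (a $(d-r)$-fold point), then $\overline{\mathcal{C}}$ can be parametrized by radicals using lines.
   Context: Let $t$ be transcendental over $\mathbb{F}$, $\mathbb{K}=\mathbb{F}(t)$, and fix an algebraic closure $\overline{\mathbb{K}}$ of $\mathbb{K}$. Root towers. For $g\in\mathbb{K}[x]$, a root tower for $g$ over $\mathbb{K}$ is a finite tower of fields $\mathbb{K}=\mathbb{K}_0\subset\mathbb{K}_1\subset\cdots\subset\mathbb{K}_s=\mathbb{E}$ (inside $\overline{\mathbb{K}}$) such that each $\mathbb{K}_i$ is the splitting field over $\mathbb{K}_{i-1}$ of a polynomial $x^{\ell_i}-a_i\in\mathbb{K}_{i-1}[x]$ with $\ell_i>0$, $a_i\neq0$, and the splitting field of $g$ over $\mathbb{K}$ is contained in $\mathbb{K}_s$; $g$ is soluble (by radicals) over $\mathbb{K}$ if such a tower exists. Projective square parametrization: a point $(R_1:\cdots:R_{n+1})\in\mathbb{P}^n(\mathbb{E})\setminus\mathbb{P}^n(\mathbb{F})$, where $\mathbb{E}$ is the last field of a root tower over $\mathbb{K}$ of some $g\in\mathbb{K}[x]$ soluble over $\mathbb{K}$. Evaluation. For each $t_0\in\mathbb{F}$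 fix a place of $\overline{\mathbb{K}}$ over $\mathbb{F}$ extending $t\mapsto t_0$, i.e. a valuation ring $O_{t_0}\supset\mathbb{F}$ of $\overline{\mathbb{K}}$ with $t-t_0$ in its maximal ideal; its residue field is $\mathbb{F}$ (this is a compatible choice of the values at $t_0$ of all radicals). $S(t_0)$ is well defined if $S\in O_{t_0}$, and then it is the residue of $S$ in $\mathbb{F}$. For a projective square parametrization with fixed representative coordinates, $\mathcal{P}(t_0)$ is defined if all coordinates are defined at $t_0$ and their values are not all zero, and it is the point with those values as coordinates. Parametrizable by radicals (projective). An irreducible projective curve is parametrizable by radicals if there is a finite set of projective square parametrizations $\{\mathcal{P}_i(t)\}_i$ (a radical parametrization) such that (1) whenever $\mathcal{P}_i(t_0)$ is defined, $t_0\in\mathbb{F}$, it lies on the curve; (2) all but finitely many points of the curve are of the form $\mathcal{P}_i(t_0)$ for some $i$ and some $t_0\in\mathbb{F}$. Using lines. $\overline{\mathcal{C}}$ can be parametrized by radicals using lines if, for the $(d-r)$-fold point $P$ and a pencil of lines $L_1+tL_2=0$ through $P$ ($L_1,L_2$ linearly independent linear forms over $\mathbb{F}$ vanishing at $P$), the intersection points over $\overline{\mathbb{K}}$ of $\overline{\mathcal{C}}$ with the line $L_1+tL_2=0$, other than $P$, form a radical parametrization of $\overline{\mathcal{C}}$. *)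

theory Defs
  imports
    "HOL-Analysis.Finite_Cartesian_Product"
    "HOL-Algebra.Generated_Fields"
    "HOL-Algebra.Algebraic_Closure_Type"
begin

text \<open>
  Throughout, \<open>'a\<close> is the ground field F. The rational function field K = F(t) is the library type
  \<open>'a poly fract\<close>, and \<open>'a poly fract alg_closure\<close> is its algebraic closure. Subfields and subrings
  of the closure are sets in the HOL-Algebra sense, taken in \<open>ring_of_type_algebra\<close>.
\<close>

type_synonym 'a kbar = "'a poly fract alg_closure"

definition const :: "'a::field \<Rightarrow> 'a kbar" where
  "const c = to_ac (to_fract [:c:])"

definition tvar :: "'a::field kbar" where
  "tvar = to_ac (to_fract [:0, 1:])"


section \<open>Projective space\<close>

text \<open>A projective point is the set of all its coordinate vectors.\<close>

definition proj_point :: "'b::field ^ 'n \<Rightarrow> ('b ^ 'n) set" where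
  "proj_point v = {c *s v | c. c \<noteq> 0}"

definition proj_space :: "('b::field ^ 'n) set set" where
  "proj_space = proj_point ` {v. v \<noteq> 0}"

text \<open>For a subfield E of the field \<open>'b\<close>, the points having coordinates in E.\<close>

definition proj_space_over :: "'b::field set \<Rightarrow> ('b ^ 'n) set set" where
  "proj_space_over E = proj_point ` {v. v \<noteq> 0 \<and> (\<forall>i. v $ i \<in> E)}"


section \<open>Plane curves\<close>

text \<open>
  A polynomial in x, y is an \<open>'a poly poly\<close> and a polynomial in x, y, z an \<open>'a poly poly poly\<close>,
  with x the innermost and the last variable the outermost one.
\<close>

definition eval2 :: "'b::comm_ring_1 poly poly \<Rightarrow> 'b \<times> 'b \<Rightarrow> 'b" where
  "eval2 f = (\<lambda>(x, y). poly (poly f [:y:]) x)"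

definition eval3 :: "'b::comm_ring_1 poly poly poly \<Rightarrow> 'b ^ 3 \<Rightarrow> 'b" where
  "eval3 F v = poly (poly (poly F [:[:v $ 3:]:]) [:v $ 2:]) (v $ 1)"

definition coeff3 :: "'b::zero poly poly poly \<Rightarrow> nat \<Rightarrow> nat \<Rightarrow> nat \<Rightarrow> 'b" where
  "coeff3 F i j k = Polynomial.coeff (Polynomial.coeff (Polynomial.coeff F k) j) i"

definition is_form :: "nat \<Rightarrow> 'b::zero poly poly poly \<Rightarrow> bool" where
  "is_form n F \<longleftrightarrow> (\<forall>i j k. coeff3 F i j k \<noteq> 0 \<longrightarrow> i + j + k = n)"

definition irreducible_affine_curve :: "('a::field \<times> 'a) set \<Rightarrow> bool" where
  "irreducible_affine_curve C \<longleftrightarrow>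
     (\<exists>f. Factorial_Ring.irreducible f \<and> C = {p. eval2 f p = 0})"

definition proj_zeros :: "'b::field poly poly poly \<Rightarrow> ('b ^ 3) set set" where
  "proj_zeros F = proj_point ` {v. v \<noteq> 0 \<and> eval3 F v = 0}"

definition affine_point :: "'a::field \<times> 'a \<Rightarrow> ('a ^ 3) set" where
  "affine_point = (\<lambda>(x, y). proj_point (\<chi> i. if i = 1 then x else if i = 2 then y else 1))"

text \<open>The closure in the Zariski topology of the projective plane, whose basic closed sets are the
  zero sets of forms.\<close>

definition proj_closure :: "('a::field \<times> 'a) set \<Rightarrow> ('a ^ 3) set set" where
  "proj_closure C =
     proj_space \<inter> \<Inter> {proj_zeros G | G n. is_form n G \<and> affine_point ` C \<subseteq> proj_zeros G}"

text \<open>The irreducible form defining an irreducible projective plane curve; over an algebraically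
  closed field it is unique up to a nonzero constant factor, so the notions below do not depend on
  the choice.\<close>

definition defining_form :: "('a::field ^ 3) set set \<Rightarrow> 'a poly poly poly" where
  "defining_form \<Gamma> =
     (SOME F. Factorial_Ring.irreducible F \<and> (\<exists>n. is_form n F) \<and> \<Gamma> = proj_zeros F)"

definition curve_degree :: "('a::field ^ 3) set set \<Rightarrow> nat" where
  "curve_degree \<Gamma> = (THE n. is_form n (defining_form \<Gamma>))"

definition partial_deriv ::
  "nat \<Rightarrow> nat \<Rightarrow> nat \<Rightarrow> 'a::field poly poly poly \<Rightarrow> 'a poly poly poly" where
  "partial_deriv i j k F =
     (map_poly (map_poly pderiv) ^^ i) ((map_poly pderiv ^^ j) ((pderiv ^^ k) F))"

text \<open>The multiplicity of P is the least order of a partial derivative of the defining form that does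
  not vanish at P; it is 0 exactly when P is not on the curve.\<close>

definition curve_multiplicity :: "('a::field ^ 3) set set \<Rightarrow> ('a ^ 3) set \<Rightarrow> nat" where
  "curve_multiplicity \<Gamma> P =
     (LEAST m. \<exists>i j k. i + j + k = m \<and> (\<exists>v\<in>P. eval3 (partial_deriv i j k (defining_form \<Gamma>)) v \<noteq> 0))"


section \<open>Root towers\<close>

definition splitting_field :: "'b::field set \<Rightarrow> 'b poly \<Rightarrow> 'b set" where
  "splitting_field E p = generate_field ring_of_type_algebra (E \<union> {x. poly p x = 0})"

definition root_tower :: "'a::field poly fract poly \<Rightarrow> 'a kbar set list \<Rightarrow> bool" where
  "root_tower g Ks \<longleftrightarrow>
     g \<noteq> 0 \<and> Ks \<noteq> [] \<and> hd Ks = range to_ac \<and>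
     (\<forall>i. Suc i < length Ks \<longrightarrow>
        (\<exists>l a. l > 0 \<and> a \<in> Ks ! i \<and> a \<noteq> 0 \<and>
           Ks ! Suc i = splitting_field (Ks ! i) (Polynomial.monom 1 l - [:a:]))) \<and>
     splitting_field (range to_ac) (map_poly to_ac g) \<subseteq> last Ks"

text \<open>The vector R is the fixed choice of representative coordinates.\<close>

definition square_parametrization :: "('a::field kbar) ^ 'n \<Rightarrow> bool" where
  "square_parametrization R \<longleftrightarrow>
     (\<exists>g Ks. root_tower g Ks \<and> (\<forall>i. R $ i \<in> last Ks)) \<and>
     R \<noteq> 0 \<and> proj_point R \<notin> proj_space_over (range const)"


section \<open>Places and evaluation\<close>

definition max_ideal :: "'b::field set \<Rightarrow> 'b set" where
  "max_ideal V = {x \<in> V. x = 0 \<or> inverse x \<notin> V}"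

text \<open>Over an algebraically closed ground field the residue field of such a valuation ring is
  the image of F, so \<open>place_value\<close> is then well defined on V.\<close>

definition place_at :: "'a::field \<Rightarrow> 'a kbar set \<Rightarrow> bool" where
  "place_at t0 V \<longleftrightarrow>
     subring V ring_of_type_algebra \<and> (\<forall>x. x \<in> V \<or> inverse x \<in> V) \<and>
     range const \<subseteq> V \<and> tvar - const t0 \<in> max_ideal V"

definition place_value :: "'a::field kbar set \<Rightarrow> 'a kbar \<Rightarrow> 'a" where
  "place_value V S = (THE c. S - const c \<in> max_ideal V)"

definition vec_value :: "'a::field kbar set \<Rightarrow> ('a kbar) ^ 'n \<Rightarrow> 'a ^ 'n" where
  "vec_value V R = (\<chi> i. place_value V (R $ i))"

definition defined_at :: "'a::field kbar set \<Rightarrow> ('a kbar) ^ 'n \<Rightarrow> bool" where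
  "defined_at V R \<longleftrightarrow> (\<forall>i. R $ i \<in> V) \<and> vec_value V R \<noteq> 0"


section \<open>Parametrization by radicals\<close>

text \<open>\<open>places t0\<close> is the valuation ring of the place chosen at \<open>t0\<close>.\<close>

definition radical_parametrization ::
  "('a::field \<Rightarrow> 'a kbar set) \<Rightarrow> ('a ^ 'n) set set \<Rightarrow> (('a kbar) ^ 'n) set \<Rightarrow> bool" where
  "radical_parametrization places \<Gamma> Rs \<longleftrightarrow>
     finite Rs \<and> (\<forall>R\<in>Rs. square_parametrization R) \<and>
     (\<forall>R\<in>Rs. \<forall>t0. defined_at (places t0) R \<longrightarrow> proj_point (vec_value (places t0) R) \<in> \<Gamma>) \<and>
     finite (\<Gamma> - {proj_point (vec_value (places t0) R) | R t0. R \<in> Rs \<and> defined_at (places t0) R})"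

definition linear_form :: "'b::comm_semiring_1 ^ 'n \<Rightarrow> 'b ^ 'n \<Rightarrow> 'b" where
  "linear_form L v = (\<Sum>i\<in>UNIV. L $ i * v $ i)"

definition is_pencil :: "('a::field ^ 3) set \<Rightarrow> 'a ^ 3 \<Rightarrow> 'a ^ 3 \<Rightarrow> bool" where
  "is_pencil P L1 L2 \<longleftrightarrow>
     (\<forall>a b. a *s L1 + b *s L2 = 0 \<longrightarrow> a = 0 \<and> b = 0) \<and>
     (\<forall>v\<in>P. linear_form L1 v = 0 \<and> linear_form L2 v = 0)"

definition const_vec :: "'a::field ^ 'n \<Rightarrow> ('a kbar) ^ 'n" where
  "const_vec v = (\<chi> i. const (v $ i))"

definition pencil_intersections ::
  "('a::field ^ 3) set set \<Rightarrow> ('a ^ 3) set \<Rightarrow> 'a ^ 3 \<Rightarrow> 'a ^ 3 \<Rightarrow> (('a kbar) ^ 3) set set" where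
  "pencil_intersections \<Gamma> P L1 L2 =
     (proj_zeros (map_poly (map_poly (map_poly const)) (defining_form \<Gamma>)) \<inter>
      proj_point ` {v. v \<noteq> 0 \<and> linear_form (const_vec L1 + tvar *s const_vec L2) v = 0})
     - (\<lambda>v. proj_point (const_vec v)) ` P"

text \<open>Every choice of a pencil through P must work; for each one, coordinates are chosen for
  each of the intersection points.\<close>

definition parametrizable_using_lines ::
  "('a::field \<Rightarrow> 'a kbar set) \<Rightarrow> ('a ^ 3) set set \<Rightarrow> ('a ^ 3) set \<Rightarrow> bool" where
  "parametrizable_using_lines places \<Gamma> P \<longleftrightarrow>
     (\<forall>L1 L2. is_pencil P L1 L2 \<longrightarrow>
        (\<exists>Rs. bij_betw proj_point Rs (pencil_intersections \<Gamma> P L1 L2) \<and>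
              radical_parametrization places \<Gamma> Rs))"

end

theory Submission
  imports Defs "HOL-Analysis.Cartesian_Space"
begin

text \<open>
  Lines through a \<open>(d - r)\<close>-fold point \<open>P\<close> of a curve of degree \<open>d\<close> meet the curve in only \<open>r\<close> further points,
  by Bezout on a line. So the intersection of the curve with the moving line \<open>L\<^sub>1 + t L\<^sub>2 = 0\<close> of a pencil
  through \<open>P\<close> is described by an equation of degree at most \<open>r \<le> 4\<close> over \<open>F(t)\<close>, and such equations are solved
  by radicals. As \<open>t\<close> varies, the lines sweep out the plane and the intersection points sweep out the
  curve.

  In detail, choose a basis \<open>p, u, w\<close> of the space with \<open>P = (p)\<close> that is dual to \<open>L\<^sub>1, L\<^sub>2\<close> on \<open>u, w\<close>. The points of
  the moving line other than \<open>P\<close> are the points \<open>s p + t u - w\<close>, and those on the curve are given by the roots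
  \<open>s\<close> of a polynomial \<open>H(t, s)\<close>, the defining form \<open>D\<close> on that line. Expanding at \<open>P\<close> instead, that is,
  replacing \<open>s\<close> by \<open>1 / \<lambda>\<close>, the multiplicity gives a factor \<open>\<lambda> ^ (d - r)\<close> (\<open>order_along_line\<close>), so that every root \<open>s \<noteq> 0\<close>
  is the inverse of a root of a polynomial of degree at most 4 and lies in the last field of a root tower
  (\<open>degree_4_radical\<close>, by the classical formulas).

  Places are ring homomorphisms over \<open>F\<close>, so values of intersection points are on the curve. Conversely,
  let \<open>Q\<close> be a point of the curve on the line \<open>L\<^sub>1 + t0 L\<^sub>2 = 0\<close>. Unless the leading coefficient of \<open>H\<close> in \<open>s\<close>
  vanishes at \<open>t0\<close>, all roots of \<open>H(t, s)\<close> are finite at \<open>t0\<close> and their values are all the roots of \<open>H(t0, s)\<close>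
  (\<open>lift_root\<close>), so \<open>Q\<close> is the value of an intersection point. What remains lies on finitely many lines through
  \<open>P\<close>. None of them is contained in the curve, as otherwise the irreducible form \<open>D\<close> would be linear, \<open>d = r = 1\<close>,
  and \<open>P\<close> would not be on the curve.

  The notions of degree and multiplicity refer to an irreducible form whose zeros are the Zariski closure of
  the affine curve. Its existence is a theorem (\<open>proj_closure_eq_proj_zeros\<close>): the homogenisation of an
  irreducible polynomial \<open>f\<close> is irreducible, and it divides every form vanishing on the affine curve, since
  \<open>f\<close> divides every polynomial that vanishes on its zeros (\<open>plane_nullstellensatz\<close>).
\<close>

(* The dollar sign denotes components of vectors throughout. *)
no_notation fps_nth (infixl \<open>$\<close> 75)

hide_const (open) UnivPoly.monom UnivPoly.coeff Divisibility.irreducible Divisibility.prime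

section \<open>Evaluation along ring homomorphisms\<close>

text \<open>
  Curves, restrictions to lines and places are all handled through evaluation of a polynomial along
  a homomorphism of its coefficients, so that one polynomial over \<open>F\<close> can be evaluated at points
  with coordinates in \<open>F\<close>, in \<open>F[\<lambda>]\<close>, in \<open>F[t][s]\<close> or in the closure of \<open>F(t)\<close>.
\<close>

definition is_hom :: "('a::comm_ring_1 \<Rightarrow> 'b::comm_ring_1) \<Rightarrow> bool" where
  "is_hom h \<longleftrightarrow> h 0 = 0 \<and> h 1 = 1 \<and> (\<forall>x y. h (x + y) = h x + h y) \<and> (\<forall>x y. h (x * y) = h x * h y)"

lemma is_homD:
  assumes "is_hom h"
  shows "h 0 = 0" "h 1 = 1" "h (x + y) = h x + h y" "h (x * y) = h x * h y"
  using assms by (auto simp: is_hom_def)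

lemma is_hom_uminus: "is_hom h \<Longrightarrow> h (- x) = - h x"
  using is_homD(3)[of h x "- x"] by (simp add: is_homD eq_neg_iff_add_eq_0 add.commute)

lemma is_hom_diff: "is_hom h \<Longrightarrow> h (x - y) = h x - h y"
  using is_homD(3)[of h x "- y"] by (simp add: is_hom_uminus)

lemma is_hom_power: "is_hom h \<Longrightarrow> h (x ^ n) = h x ^ n"
  by (induction n) (auto simp: is_homD)

lemma is_hom_of_nat: "is_hom h \<Longrightarrow> h (of_nat n) = of_nat n"
  by (induction n) (auto simp: is_homD)

lemma is_hom_sum: "is_hom h \<Longrightarrow> h (sum f A) = (\<Sum>x\<in>A. h (f x))"
  by (induction A rule: infinite_finite_induct) (auto simp: is_homD)

lemma is_hom_id: "is_hom (\<lambda>x. x)"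
  by (simp add: is_hom_def)

lemma is_hom_comp: "is_hom f \<Longrightarrow> is_hom g \<Longrightarrow> is_hom (\<lambda>x. g (f x))"
  by (simp add: is_hom_def)

lemma is_hom_const_poly: "is_hom (\<lambda>c. [:c:])"
  by (simp add: is_hom_def)

lemma is_hom_const_poly2: "is_hom (\<lambda>c. [:[:c:]:])"
  by (rule is_hom_comp[OF is_hom_const_poly is_hom_const_poly])

lemma is_hom_poly: "is_hom (\<lambda>p. poly p a)"
  by (simp add: is_hom_def)

definition peval :: "('a::zero \<Rightarrow> 'b::comm_ring_1) \<Rightarrow> 'b \<Rightarrow> 'a poly \<Rightarrow> 'b" where
  "peval h w p = poly (map_poly h p) w"

lemma peval_0 [simp]: "peval h w 0 = 0"
  by (simp add: peval_def)

lemma peval_pCons: "h 0 = 0 \<Longrightarrow> peval h w (pCons a p) = h a + w * peval h w p"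
  by (simp add: peval_def map_poly_pCons)

lemma peval_sum:
  assumes "h 0 = 0" "degree p \<le> n"
  shows "peval h w p = (\<Sum>k\<le>n. h (coeff p k) * w ^ k)"
proof -
  have "degree (map_poly h p) \<le> n"
    using assms(2) map_poly_degree_leq order_trans by blast
  hence "peval h w p = (\<Sum>k\<le>n. coeff (map_poly h p) k * w ^ k)"
    unfolding peval_def by (subst poly_altdef, intro sum.mono_neutral_left) (auto simp: coeff_eq_0)
  thus ?thesis
    using assms(1) by (simp add: coeff_map_poly)
qed

lemma peval_add:
  assumes "is_hom h"
  shows "peval h w (p + q) = peval h w p + peval h w q"
proof -
  have "map_poly h (p + q) = map_poly h p + map_poly h q"
    using assms by (intro poly_eqI) (simp add: coeff_map_poly is_homD)
  thus ?thesis by (simp add: peval_def)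
qed

lemma peval_smult:
  assumes "is_hom h"
  shows "peval h w (smult c p) = h c * peval h w p"
proof -
  have "map_poly h (smult c p) = smult (h c) (map_poly h p)"
    using assms by (intro poly_eqI) (simp add: coeff_map_poly is_homD)
  thus ?thesis by (simp add: peval_def)
qed

lemma is_hom_peval:
  assumes "is_hom h"
  shows "is_hom (peval h w)"
  unfolding is_hom_def
proof (intro conjI allI)
  show "peval h w (p * q) = peval h w p * peval h w q" for p q
    by (induction p)
       (simp_all add: peval_pCons peval_add peval_smult assms is_homD[OF assms] algebra_simps)
qed (simp_all add: peval_add assms peval_pCons is_homD[OF assms] one_pCons del: pCons_one)

text \<open>
  Evaluation is natural: a homomorphism of the target commutes with it. All specialisations below
  (of \<open>t\<close>, of a parameter on a line, or passing to the closure of \<open>F(t)\<close>) are instances.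
\<close>

lemma hom_peval:
  assumes "is_hom h" "is_hom k"
  shows "k (peval h w p) = peval (\<lambda>x. k (h x)) (k w) p"
  by (induction p) (simp_all add: peval_pCons is_homD[OF assms(1)] is_homD[OF assms(2)])

lemma peval_map_poly:
  assumes "g 0 = 0" "h 0 = 0"
  shows "peval h w (map_poly g p) = peval (\<lambda>x. h (g x)) w p"
  using assms by (induction p) (simp_all add: peval_pCons map_poly_pCons)

lemma peval_id: "peval (\<lambda>x. x) w p = poly p w"
  by (simp add: peval_def)

lemma poly_poly_const: "poly (poly p [:y:]) x = peval (\<lambda>g. poly g x) y p"
  by (induction p) (simp_all add: peval_pCons)

definition ev3 :: "('a::comm_ring_1 \<Rightarrow> 'b::comm_ring_1) \<Rightarrow> 'b ^ 3 \<Rightarrow> 'a poly poly poly \<Rightarrow> 'b" where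
  "ev3 h v = peval (peval (peval h (v $ 1)) (v $ 2)) (v $ 3)"

lemma is_hom_ev3: "is_hom h \<Longrightarrow> is_hom (ev3 h v)"
  by (simp add: ev3_def is_hom_peval)

lemma hom_ev3:
  assumes "is_hom h" "is_hom k"
  shows "k (ev3 h v D) = ev3 (\<lambda>x. k (h x)) (\<chi> i. k (v $ i)) D"
  unfolding ev3_def using assms by (simp add: hom_peval is_hom_peval)

lemma eval3_eq_ev3: "eval3 D v = ev3 (\<lambda>x. x) v D"
proof -
  have *: "poly (poly (poly D [:[:z:]:]) [:y:]) x = peval (\<lambda>f. poly (poly f [:y:]) x) z D" for x y z
    by (induction D) (simp_all add: peval_pCons)
  have "(\<lambda>f. poly (poly f [:v $ 2:]) (v $ 1)) = peval (\<lambda>g. poly g (v $ 1)) (v $ 2)"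
    by (simp add: poly_poly_const)
  moreover have "(\<lambda>g. poly g (v $ 1)) = peval (\<lambda>x. x) (v $ 1)"
    by (rule ext) (simp add: peval_id)
  ultimately show ?thesis
    unfolding eval3_def ev3_def * by simp
qed

lemma eval3_map:
  assumes "is_hom h"
  shows "eval3 (map_poly (map_poly (map_poly h)) D) v = ev3 h v D"
  by (simp add: eval3_eq_ev3 ev3_def peval_map_poly is_homD[OF assms])

lemma eval2_eq: "eval2 f (x, y) = peval (\<lambda>g. poly g x) y f"
  by (simp add: eval2_def poly_poly_const)

section \<open>Forms\<close>

text \<open>
  The inductive step for homogeneity in one variable at a time: \<open>e\<close> and \<open>E\<close> carry the powers of \<open>c\<close>
  that belong to the outer variables and to the total degree.
\<close>

lemma peval_scale:
  assumes "h 0 = 0" "h' 0 = 0"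
  assumes "\<And>k. c ^ k * (e * h' (coeff p k)) = E * h (coeff p k)"
  shows "e * peval h' (c * w) p = E * peval h w p"
  unfolding peval_sum[where h = h, OF assms(1) order_refl] peval_sum[where h = h', OF assms(2) order_refl] sum_distrib_left
proof (rule sum.cong[OF refl])
  fix k
  have "e * (h' (coeff p k) * (c * w) ^ k) = (c ^ k * (e * h' (coeff p k))) * w ^ k"
    by (simp add: power_mult_distrib mult_ac)
  also have "\<dots> = E * (h (coeff p k) * w ^ k)"
    unfolding assms(3) by (simp add: mult_ac)
  finally show "e * (h' (coeff p k) * (c * w) ^ k) = E * (h (coeff p k) * w ^ k)" .
qed

lemma ev3_form:
  assumes "is_form n D" and h: "is_hom h"
  shows "ev3 h (c *s v) D = c ^ n * ev3 h v D"
proof -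
  note z = is_homD(1)[OF h]
  have 0: "c ^ i * ((c ^ k * c ^ j) * h (coeff (coeff (coeff D k) j) i)) = 
          c ^ n * h (coeff (coeff (coeff D k) j) i)" for i j k
  proof (cases "coeff (coeff (coeff D k) j) i = 0")
    case False
    hence "i + j + k = n" using assms(1) by (auto simp: is_form_def coeff3_def)
    thus ?thesis by (auto simp: power_add mult_ac)
  qed (simp add: z)
  have 1: "c ^ j * (c ^ k * peval h (c * v $ 1) (coeff (coeff D k) j)) =
           c ^ n * peval h (v $ 1) (coeff (coeff D k) j)" for j k
    using peval_scale[of h h c "c ^ k * c ^ j" "coeff (coeff D k) j" "c ^ n" "v $ 1", OF z z 0]
    by (simp add: mult_ac)
  have 2: "c ^ k * peval (peval h (c * v $ 1)) (c * v $ 2) (coeff D k) =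
           c ^ n * peval (peval h (v $ 1)) (v $ 2) (coeff D k)" for k
    by (rule peval_scale) (simp_all add: 1)
  have 3: "1 * peval (peval (peval h (c * v $ 1)) (c * v $ 2)) (c * v $ 3) D =
           c ^ n * peval (peval (peval h (v $ 1)) (v $ 2)) (v $ 3) D"
    by (rule peval_scale) (simp_all add: 2)
  thus ?thesis by (simp add: ev3_def)
qed

text \<open>
  One variable at a time, again; \<open>e\<close> is the degree already spent on the outer variables. The
  disjunction is needed because the zero polynomial has degree 0.
\<close>

lemma degree_peval:
  assumes "h 0 = 0" "degree W \<le> 1"
  assumes "\<And>k. h (coeff p k) = 0 \<or> degree (h (coeff p k)) + (k + e) \<le> n"
  shows "peval h W p = 0 \<or> degree (peval h W p) + e \<le> n"
proof (cases "e \<le> n")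
  case True
  have "degree (h (coeff p k) * W ^ k) \<le> n - e" for k
  proof (cases "h (coeff p k) = 0")
    case False
    have "degree (h (coeff p k) * W ^ k) \<le> degree (h (coeff p k)) + degree (W ^ k)"
      by (rule degree_mult_le)
    also have "degree (W ^ k) \<le> k"
      using degree_power_le[of W k] assms(2) by (metis mult_le_mono1 mult_1 order_trans)
    finally show ?thesis using assms(3)[of k] False by linarith
  qed auto
  hence "degree (peval h W p) \<le> n - e"
    unfolding peval_sum[where h = h, OF assms(1) order_refl] by (intro degree_sum_le) auto
  thus ?thesis using True by linarith
next
  case False
  hence "h (coeff p k) = 0" for k using assms(3)[of k] by linarith
  thus ?thesis unfolding peval_sum[where h = h, OF assms(1) order_refl] by simp
qed

lemma degree_ev3_form:
  fixes D :: "'a::comm_ring_1 poly poly poly" and W :: "'b::comm_ring_1 poly ^ 3"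
  assumes "is_form n D" and h: "is_hom h" and "\<And>i. degree (W $ i) \<le> 1"
  shows "degree (ev3 (\<lambda>c. [:h c:]) W D) \<le> n"
proof -
  let ?h = "\<lambda>c. [:h c:]"
  have z: "?h 0 = 0" by (simp add: is_homD[OF h])
  have 0: "?h (coeff (coeff (coeff D k) j) i) = 0 \<or> 
      degree (?h (coeff (coeff (coeff D k) j) i)) + (i + (j + k)) \<le> n" for i j k
    using assms(1) by (cases "coeff (coeff (coeff D k) j) i = 0")
      (force simp: is_homD[OF h] is_form_def coeff3_def)+
  have 1: "peval ?h (W $ 1) (coeff (coeff D k) j) = 0 \<or>
    degree (peval ?h (W $ 1) (coeff (coeff D k) j)) + (j + k) \<le> n" for j k
    by (rule degree_peval[where h = ?h, OF z assms(3) 0])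
  have 2: "peval (peval ?h (W $ 1)) (W $ 2) (coeff D k) = 0 \<or>
    degree (peval (peval ?h (W $ 1)) (W $ 2) (coeff D k)) + k \<le> n" for k
    by (rule degree_peval[where h = "peval ?h (W $ 1)", OF peval_0 assms(3) 1])
  have 3: "peval (peval (peval ?h (W $ 1)) (W $ 2)) (W $ 3) D = 0 \<or>
    degree (peval (peval (peval ?h (W $ 1)) (W $ 2)) (W $ 3) D) + 0 \<le> n"
    by (rule degree_peval[where h = "peval (peval ?h (W $ 1)) (W $ 2)", OF peval_0 assms(3)]) (simp add: 2)
  thus ?thesis by (auto simp: ev3_def)
qed

section \<open>Polynomials as functions\<close>

lemma peval_eq_0_imp:
  fixes p :: "'a::zero poly" and h :: "'a \<Rightarrow> 'b::{idom,ring_char_0}"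
  assumes "h 0 = 0" "\<And>w. peval h w p = 0"
  shows "h (coeff p k) = 0"
proof -
  have "map_poly h p = 0"
    using assms(2) poly_all_0_iff_0[of "map_poly h p"] by (simp add: peval_def)
  thus ?thesis using assms(1) by (metis coeff_map_poly coeff_0)
qed

lemma ev3_eq_0_imp:
  fixes D :: "'a::{idom,ring_char_0} poly poly poly"
  assumes "\<And>v. ev3 (\<lambda>x. x) v D = 0"
  shows "D = 0"
proof (intro poly_eqI)
  fix i j k
  let ?h = "\<lambda>x::'a. x"
  have 0: "peval (peval (peval ?h x) y) z D = 0" for x y z
    using assms[of "vector [x, y, z]"] by (simp add: ev3_def)
  have 1: "peval (peval ?h x) y (coeff D k) = 0" for x y
    by (rule peval_eq_0_imp[OF _ 0]) simp
  have 2: "peval ?h x (coeff (coeff D k) j) = 0" for x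
    by (rule peval_eq_0_imp[OF _ 1]) simp
  have 3: "coeff (coeff (coeff D k) j) i = 0"
    by (rule peval_eq_0_imp[OF _ 2]) simp
  thus "coeff (coeff (coeff D k) j) i = coeff (coeff (coeff 0 k) j) i" by simp
qed

lemma ev2_eq_0_imp:
  fixes f :: "'a::{idom,ring_char_0} poly poly"
  assumes "\<And>x y. peval (\<lambda>g. poly g x) y f = 0"
  shows "f = 0"
proof (intro poly_eqI)
  fix i j
  have 1: "poly (coeff f j) x = 0" for x
    by (rule peval_eq_0_imp[OF _ assms]) simp
  thus "coeff (coeff f j) i = coeff (coeff 0 j) i"
    using poly_all_0_iff_0[of "coeff f j"] by auto
qed

section \<open>Order of vanishing along a line\<close>

text \<open>
  Product rule: the derivative falls either on the coefficients or on the point of evaluation.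
  Three nested uses give the chain rule in three variables.
\<close>

lemma pderiv_peval:
  fixes h :: "'a::idom \<Rightarrow> 'b::idom poly"
  assumes "is_hom h"
  shows "pderiv (peval h W p) = peval (\<lambda>a. pderiv (h a)) W p + pderiv W * peval h W (pderiv p)"
proof (induction p)
  case (pCons a p)
  have *: "peval h W (pderiv (pCons a p)) = peval h W p + W * peval h W (pderiv p)"
    by (simp add: pderiv_pCons peval_add assms peval_pCons is_homD[OF assms])
  show ?case
    by (simp add: peval_pCons is_homD[OF assms] pderiv_add pderiv_mult pCons * algebra_simps)
qed simp

lemma peval_fun_add:
  assumes "f 0 = 0" "g 0 = 0"
  shows "peval (\<lambda>a. f a + g a) W p = peval f W p + peval g W p"
  using assms by (induction p) (simp_all add: peval_pCons algebra_simps)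

lemma peval_fun_mult:
  assumes "f 0 = 0"
  shows "peval (\<lambda>a. c * f a) W p = c * peval f W p"
  using assms by (induction p) (simp_all add: peval_pCons algebra_simps)

lemma pderiv_ev3:
  fixes h :: "'a::idom \<Rightarrow> 'b::idom" and W :: "'b poly ^ 3"
  assumes "is_hom h"
  shows "pderiv (ev3 (\<lambda>c. [:h c:]) W D) =
     pderiv (W $ 1) * ev3 (\<lambda>c. [:h c:]) W (map_poly (map_poly pderiv) D) +
     pderiv (W $ 2) * ev3 (\<lambda>c. [:h c:]) W (map_poly pderiv D) +
     pderiv (W $ 3) * ev3 (\<lambda>c. [:h c:]) W (pderiv D)"
proof -
  let ?h = "\<lambda>c. [:h c:]"
  have h: "is_hom ?h" using is_hom_comp[OF assms is_hom_const_poly] .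
  have z: "peval (\<lambda>a. 0) W p = 0" for W :: "'b poly" and p :: "'a poly"
    by (induction p) (simp_all add: peval_pCons)
  have 1: "(\<lambda>g. pderiv (peval ?h (W $ 1) g)) = (\<lambda>g. pderiv (W $ 1) * peval ?h (W $ 1) (pderiv g))"
    by (rule ext, subst pderiv_peval[OF h]) (simp add: z)
  have 2: "(\<lambda>f. pderiv (peval (peval ?h (W $ 1)) (W $ 2) f)) = (\<lambda>f. 
      pderiv (W $ 1) * peval (peval ?h (W $ 1)) (W $ 2) (map_poly pderiv f)
    + pderiv (W $ 2) * peval (peval ?h (W $ 1)) (W $ 2) (pderiv f))"
    by (rule ext, subst pderiv_peval)
       (simp_all add: is_hom_peval h 1 peval_fun_mult peval_map_poly)
  show ?thesis
    unfolding ev3_def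
    by (subst pderiv_peval)
       (simp_all add: is_hom_peval h 2 peval_fun_add peval_fun_mult peval_map_poly)
qed

lemma map_poly_pderiv_commute:
  fixes D :: "'a::idom \<Rightarrow> 'a"
  assumes "D 0 = 0" "\<And>x y. D (x + y) = D x + D y"
  shows "map_poly D (pderiv p) = pderiv (map_poly D p)"
proof (rule poly_eqI)
  fix n
  have "D (of_nat m * c) = of_nat m * D c" for m c
    by (induction m) (simp_all add: assms algebra_simps)
  thus "coeff (map_poly D (pderiv p)) n = coeff (pderiv (map_poly D p)) n"
    by (simp only: coeff_map_poly assms coeff_pderiv)
qed

lemma map_poly_add_hom:
  assumes "D 0 = 0" "\<And>x y. D (x + y) = D x + D y"
  shows "map_poly D (p + q) = map_poly D p + map_poly D q"
  by (rule poly_eqI) (simp add: coeff_map_poly assms)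

lemma funpow_commute:
  assumes "\<And>x. f (g x) = g (f x)"
  shows "(f ^^ n) (g x) = g ((f ^^ n) x)"
  by (induction n) (simp_all add: assms)

lemma partial_deriv_Suc:
  fixes D :: "'a::field poly poly poly"
  shows "partial_deriv i j k (map_poly (map_poly pderiv) D) = partial_deriv (Suc i) j k D"
    "partial_deriv i j k (map_poly pderiv D) = partial_deriv i (Suc j) k D"
    "partial_deriv i j k (pderiv D) = partial_deriv i j (Suc k) D"
proof -
  let ?x = "map_poly (map_poly pderiv) :: 'a poly poly poly \<Rightarrow> _"
  let ?y = "map_poly pderiv :: 'a poly poly poly \<Rightarrow> _"
  have xz: "pderiv (?x p) = ?x (pderiv p)" for p
    by (rule map_poly_pderiv_commute[symmetric]) (simp_all add: map_poly_add_hom pderiv_add)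
  have yz: "pderiv (?y p) = ?y (pderiv p)" for p
    by (rule map_poly_pderiv_commute[symmetric]) (simp_all add: pderiv_add)
  have "pderiv (map_poly pderiv p) = map_poly pderiv (pderiv p)" for p :: "'a poly poly"
    by (rule map_poly_pderiv_commute[symmetric]) (simp_all add: pderiv_add)
  hence xy: "?y (?x p) = ?x (?y p)" for p
    by (simp add: map_poly_map_poly o_def)
  show "partial_deriv i j k (?x D) = partial_deriv (Suc i) j k D"
    unfolding partial_deriv_def
    by (simp add: funpow_commute[of pderiv ?x, OF xz] funpow_commute[of ?y ?x, OF xy] funpow_swap1)
  show "partial_deriv i j k (?y D) = partial_deriv i (Suc j) k D"
    unfolding partial_deriv_def
    by (simp add: funpow_commute[of pderiv ?y, OF yz] funpow_swap1)
  show "partial_deriv i j k (pderiv D) = partial_deriv i j (Suc k) D"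
    unfolding partial_deriv_def
    by (simp add: funpow_swap1)
qed

text \<open>
  A point of multiplicity \<open>m\<close> is a zero of order at least \<open>m\<close> on every line through it. Instead of
  Taylor's formula, induct on the order: the derivative of \<open>\<lambda> \<mapsto> D(P + \<lambda>w)\<close> is a combination of the
  same expressions for the three partial derivatives of \<open>D\<close>, whose partial derivatives vanish at \<open>P\<close>
  up to one order less; characteristic zero allows dividing by \<open>n + 1\<close>.
\<close>

lemma order_along_line:
  fixes D :: "'a::field poly poly poly" and h :: "'a \<Rightarrow> 'b::{idom,ring_char_0}"
  assumes h: "is_hom h"
    and "\<And>i j k. i + j + k < m \<Longrightarrow> eval3 (partial_deriv i j k D) P = 0"
    and "n < m"
  shows "coeff (ev3 (\<lambda>c. [:h c:]) (\<chi> i. [:h (P $ i), w $ i:]) D) n = 0"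
  using assms(2,3)
proof (induction n arbitrary: m D)
  case 0
  let ?W = "\<chi> i. [:h (P $ i), w $ i:]"
  have hc: "is_hom (\<lambda>c. [:h c:])" using is_hom_comp[OF h is_hom_const_poly] .
  have "coeff (ev3 (\<lambda>c. [:h c:]) ?W D) 0 = poly (ev3 (\<lambda>c. [:h c:]) ?W D) 0"
    by (simp add: poly_0_coeff_0)
  also have "\<dots> = ev3 h (\<chi> i. h (P $ i)) D"
    by (subst hom_ev3[OF hc is_hom_poly]) (simp add: vec_eq_iff)
  also have "\<dots> = h (ev3 (\<lambda>x. x) P D)"
    by (simp add: hom_ev3[OF is_hom_id h])
  also have "ev3 (\<lambda>x. x) P D = 0"
    using 0(1)[of 0 0 0] 0(2) by (simp add: partial_deriv_def eval3_eq_ev3)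
  finally show ?case by (simp add: is_homD[OF h])
next
  case (Suc n)
  let ?W = "\<chi> i. [:h (P $ i), w $ i:]"
  let ?E = "ev3 (\<lambda>c. [:h c:]) ?W"
  obtain m' where m': "m = Suc m'" using Suc.prems(2) by (cases m) auto
  have "coeff (?E (map_poly (map_poly pderiv) D)) n = 0"
       "coeff (?E (map_poly pderiv D)) n = 0" "coeff (?E (pderiv D)) n = 0"
    by (rule Suc.IH[of m'], simp only: partial_deriv_Suc,
         rule Suc.prems, use Suc.prems(2) m' in simp_all)+
  hence "coeff (pderiv (?E D)) n = 0"
    by (subst pderiv_ev3[OF h]) (simp add: pderiv_pCons)
  hence "of_nat (Suc n) * coeff (?E D) (Suc n) = 0"
    by (simp only: coeff_pderiv)
  thus ?case by (simp del: of_nat_Suc)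
qed

section \<open>The Nullstellensatz for plane curves\<close>

lemma prime_elem_linear: "prime_elem [:- a, 1 :: 'a::field:]"
proof (rule prime_elemI)
  fix p q assume "[:- a, 1:] dvd p * q"
  thus "[:- a, 1:] dvd p \<or> [:- a, 1:] dvd q"
    by (simp add: poly_eq_0_iff_dvd[symmetric])
next
  show "\<not> [:- a, 1:] dvd 1" by (simp add: poly_eq_0_iff_dvd[symmetric])
qed simp

lemma smult_cancel:
  fixes c :: "'a::idom"
  assumes "c \<noteq> 0" "smult c p = smult c q"
  shows "p = q"
  using assms by (simp add: poly_eq_iff)

text \<open>
  Gauss's lemma in the form in which it is needed. As \<open>F\<close> is algebraically closed, \<open>c\<close> is a product of
  linear factors; each of them is prime also in \<open>F[x][y]\<close>, so it can be moved into \<open>h\<close> or into \<open>q\<close>.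
\<close>

lemma gauss_factor:
  fixes c :: "'a::alg_closed_field poly" and p h q :: "'a poly poly"
  assumes "c \<noteq> 0" "smult c p = h * q"
  shows "\<exists>a b h' q'. a \<noteq> 0 \<and> b \<noteq> 0 \<and> h = smult a h' \<and> q = smult b q' \<and> p = h' * q'"
  using assms
proof (induction "degree c" arbitrary: c h q)
  case 0
  then obtain k where k: "c = [:k:]" "k \<noteq> 0" by (metis degree_eq_zeroE pCons_eq_0_iff)
  have "smult [:inverse k:] (smult c p) = p"
    using k by (simp add: one_pCons[symmetric])
  hence "p = h * smult [:inverse k:] q" using 0(3) by simp
  moreover have "q = smult [:k:] (smult [:inverse k:] q)" "h = smult 1 h"
    using k by (simp_all add: one_pCons[symmetric])
  moreover have "[:k:] \<noteq> 0" using k by simp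
  ultimately show ?case by (metis one_neq_zero)
next
  case (Suc n)
  then obtain x where "poly c x = 0"
    using alg_closed_imp_poly_has_root[of c] by auto
  then obtain c' where c': "c = [:- x, 1:] * c'"
    by (metis poly_eq_0_iff_dvd dvdE)
  have "c' \<noteq> 0" using c' Suc.prems by auto
  have deg: "n = degree c'"
    using Suc(2) \<open>c' \<noteq> 0\<close> unfolding c' by (subst (asm) degree_mult_eq) auto
  let ?l = "[:- x, 1:]"
  have l0: "?l \<noteq> 0" by simp
  have "[:?l:] dvd h * q"
    unfolding Suc.prems(2)[symmetric] c' by (simp add: const_poly_dvd_iff del: mult_pCons_left)
  hence "[:?l:] dvd h \<or> [:?l:] dvd q"
    using lift_prime_elem_poly[OF prime_elem_linear] prime_elem_dvd_mult_iff by blast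
  thus ?case
  proof
    assume "[:?l:] dvd h"
    then obtain h1 where h1: "h = smult ?l h1" by (auto elim!: dvdE)
    have "smult ?l (smult c' p) = smult ?l (h1 * q)"
      using Suc.prems(2) unfolding c' h1 by (simp only: smult_smult mult_smult_left)
    hence "smult c' p = h1 * q" by (rule smult_cancel[OF l0])
    from Suc.hyps(1)[OF deg \<open>c' \<noteq> 0\<close> this] obtain a b h' q' where
      *: "a \<noteq> 0" "b \<noteq> 0" "h1 = smult a h'" "q = smult b q'" "p = h' * q'" by blast
    have "h = smult (?l * a) h'" using h1 *(3) by (simp only: smult_smult)
    moreover have "?l * a \<noteq> 0" using *(1) l0 by (metis mult_eq_0_iff)
    ultimately show ?case using * by blast
  next
    assume "[:?l:] dvd q"
    then obtain q1 where q1: "q = smult ?l q1" by (auto elim!: dvdE)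
    have "smult ?l (smult c' p) = smult ?l (h * q1)"
      using Suc.prems(2) unfolding c' q1 by (simp only: smult_smult mult_smult_right)
    hence "smult c' p = h * q1" by (rule smult_cancel[OF l0])
    from Suc.hyps(1)[OF deg \<open>c' \<noteq> 0\<close> this] obtain a b h' q' where
      *: "a \<noteq> 0" "b \<noteq> 0" "h = smult a h'" "q1 = smult b q'" "p = h' * q'" by blast
    have "q = smult (?l * b) q'" using q1 *(4) by (simp only: smult_smult)
    moreover have "?l * b \<noteq> 0" using *(2) l0 by (metis mult_eq_0_iff)
    ultimately show ?case using * by blast
  qed
qed

lemma irreducible_dvd_smult:
  fixes f g :: "'a::alg_closed_field poly poly"
  assumes f: "irreducible f" and "degree f > 0" and "c \<noteq> 0" and "f dvd smult c g"
  shows "f dvd g"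
proof -
  obtain q where "smult c g = f * q" using assms(4) by (elim dvdE)
  from gauss_factor[OF assms(3) this] obtain a b f' q' where
    *: "a \<noteq> 0" "b \<noteq> 0" "f = smult a f'" "q = smult b q'" "g = f' * q'" by blast
  have "f = [:a:] * f'" using *(3) by simp
  hence "is_unit [:a:] \<or> is_unit f'" using f irreducibleD by blast
  moreover have "\<not> is_unit f'"
  proof
    assume "is_unit f'"
    hence "degree f' = 0" by (auto simp: is_unit_poly_iff)
    thus False using *(3) assms(2) by (simp split: if_splits)
  qed
  ultimately have "f dvd f'"
    using \<open>f = [:a:] * f'\<close> by (metis dvd_refl mult_unit_dvd_iff')
  thus ?thesis using * by (metis dvd_mult2)
qed

text \<open>
  Elimination of \<open>y\<close> without resultants: take an element \<open>h\<close> of least degree in \<open>y\<close> in the ideal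
  \<open>(f, g)\<close>. Pseudo-division shows that \<open>h\<close> divides multiples of \<open>f\<close> and of \<open>g\<close> by nonzero polynomials in
  \<open>x\<close>. By Gauss's lemma \<open>h\<close> is then a polynomial in \<open>x\<close>, or else \<open>f\<close> divides \<open>h\<close> and hence \<open>g\<close>.
\<close>

lemma coprime_elimination:
  fixes f g :: "'a::alg_closed_field poly poly"
  assumes f: "irreducible f" and d: "degree f > 0" and ndvd: "\<not> f dvd g"
  shows "\<exists>a b r. r \<noteq> 0 \<and> a * f + b * g = [:r:]"
proof -
  define I where "I = {h. h \<noteq> 0 \<and> (\<exists>a b. h = a * f + b * g)}"
  have I: "u * h + v * k \<in> I \<or> u * h + v * k = 0" 
    if hI: "h = 0 \<or> h \<in> I" and kI: "k = 0 \<or> k \<in> I" for h k u v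
  proof -
    have 0: "\<exists>a b. (0 :: 'a poly poly) = a * f + b * g"
      by (rule exI[of _ 0], rule exI[of _ 0]) simp
    obtain a b where ab: "h = a * f + b * g" using hI 0 unfolding I_def by blast
    obtain a' b' where ab': "k = a' * f + b' * g" using kI 0 unfolding I_def by blast
    have "u * h + v * k = (u * a + v * a') * f + (u * b + v * b') * g"
      unfolding ab ab' by (simp add: algebra_simps)
    thus ?thesis unfolding I_def by blast
  qed
  have "f \<noteq> 0" using d by auto
  have "f = 1 * f + 0 * g" by simp
  hence fI: "f \<in> I" unfolding I_def using \<open>f \<noteq> 0\<close> by blast
  have "g = 0 * f + 1 * g" by simp
  hence gI: "g = 0 \<or> g \<in> I" unfolding I_def by blast
  \<comment> \<open>An element of the ideal of least degree in \<open>y\<close>; the remainder of a pseudo-division by it is 0.\<close>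
  obtain h where h: "h \<in> I" "\<And>k. k \<in> I \<Longrightarrow> degree h \<le> degree k"
    using fI ex_has_least_nat[of "\<lambda>h. h \<in> I" f degree] by blast
  have h0: "h \<noteq> 0" using h(1) by (simp add: I_def)
  have div: "\<exists>c q. c \<noteq> 0 \<and> smult c p = h * q" if p: "p = 0 \<or> p \<in> I" for p
  proof -
    obtain q r where qr: "pseudo_divmod p h = (q, r)" by fastforce
    define c where "c = coeff h (degree h) ^ (Suc (degree p) - degree h)"
    have 1: "smult c p = h * q + r" "r = 0 \<or> degree r < degree h"
      using pseudo_divmod[OF h0 qr] by (auto simp: c_def)
    have "r = [:c:] * p + (- q) * h" using 1(1) by simp
    hence "r \<in> I \<or> r = 0" using I[of p h "[:c:]" "-q"] p h(1) by auto
    hence "r = 0" using 1(2) h(2)[of r] by auto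
    moreover have "c \<noteq> 0" using h0 by (simp add: c_def)
    ultimately show ?thesis using 1(1) by auto
  qed
  obtain c q where cq: "c \<noteq> 0" "smult c f = h * q" using div fI by blast
  from gauss_factor[OF this] obtain a b h' q' where
    *: "a \<noteq> 0" "b \<noteq> 0" "h = smult a h'" "q = smult b q'" "f = h' * q'" by blast
  have "is_unit h' \<or> is_unit q'" using f *(5) irreducibleD by blast
  thus ?thesis
  proof
    assume "is_unit h'"
    hence "degree h' = 0" by (auto simp: is_unit_poly_iff)
    then obtain u where u: "h' = [:u:]" by (metis degree_eq_zeroE)
    hence "h = [:a * u:]" using *(3) by simp
    moreover from this have "a * u \<noteq> 0" using h0 by auto
    moreover have "\<exists>a b. h = a * f + b * g" using h(1) unfolding I_def by blast
    ultimately show ?thesis by metis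
  next
    assume "is_unit q'"
    hence "f dvd h'" using *(5) by (metis dvd_refl mult_unit_dvd_iff)
    hence fh: "f dvd h" using *(3) by (metis dvd_smult)
    obtain c' q'' where c': "c' \<noteq> 0" "smult c' g = h * q''" using div gI by blast
    have "f dvd smult c' g" using fh c'(2) by (metis dvd_mult2)
    hence "f dvd g" using irreducible_dvd_smult[OF f d c'(1)] by blast
    thus ?thesis using ndvd by blast
  qed
qed

text \<open>
  If \<open>f\<close> did not divide \<open>g\<close>, elimination would give a nonzero \<open>r(x)\<close> vanishing at the abscissa of every
  point of the curve \<open>f = 0\<close>; but when \<open>f\<close> involves \<open>y\<close>, all but finitely many abscissas occur. If \<open>f\<close> does
  not involve \<open>y\<close>, the curve is a vertical line.
\<close>

lemma plane_nullstellensatz: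
  fixes f g :: "'a::{alg_closed_field,field_char_0} poly poly"
  assumes f: "irreducible f"
    and van: "\<And>x y. peval (\<lambda>c. poly c x) y f = 0 \<Longrightarrow> peval (\<lambda>c. poly c x) y g = 0"
  shows "f dvd g"
proof (cases "degree f > 0")
  case True
  show ?thesis
  proof (rule ccontr)
    assume "\<not> f dvd g"
    then obtain a b r where r: "r \<noteq> 0" "a * f + b * g = [:r:]"
      using coprime_elimination[OF f True] by blast
    have "lead_coeff f * r \<noteq> 0" using r(1) True by auto
    then obtain x where x: "poly (lead_coeff f * r) x \<noteq> 0"
      using poly_all_0_iff_0 by blast
    let ?e = "\<lambda>c. poly c x"
    have "degree (map_poly ?e f) = degree f"
      using x by (intro map_poly_degree_eq) auto
    then obtain y where y: "peval ?e y f = 0"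
      using alg_closed_imp_poly_has_root[of "map_poly ?e f"] True by (auto simp: peval_def)
    have H: "is_hom (peval ?e y)" by (intro is_hom_peval is_hom_poly)
    have "peval ?e y (a * f + b * g) = 0"
      using y van[OF y] by (simp add: is_homD[OF H])
    hence "poly r x = 0" unfolding r(2) by (simp add: peval_pCons)
    thus False using x by simp
  qed
next
  case False
  then obtain a where a: "f = [:a:]" by (metis degree_eq_zeroE neq0_conv)
  have "degree a > 0"
  proof (rule ccontr)
    assume "\<not> degree a > 0"
    then obtain k where k: "a = [:k:]" by (metis degree_eq_zeroE neq0_conv)
    have "k \<noteq> 0" using f a k by auto
    hence "is_unit f" using a k by (simp add: is_unit_const_poly_iff dvd_field_iff)
    thus False using f by (simp add: irreducible_def)
  qed
  then obtain x where x: "poly a x = 0" using alg_closed_imp_poly_has_root by blast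
  then obtain b where b: "a = [:- x, 1:] * b" by (metis poly_eq_0_iff_dvd dvdE)
  have "f = [:[:- x, 1:]:] * [:b:]" using a b by simp
  moreover have "\<not> is_unit [:[:- x, 1:]:]"
    by (simp add: is_unit_const_poly_iff poly_eq_0_iff_dvd[symmetric])
  ultimately have ub: "is_unit [:b:]" using f irreducibleD by blast
  have "peval (\<lambda>c. poly c x) y f = 0" for y
    by (simp add: a peval_pCons x)
  hence "peval (\<lambda>c. poly c x) y g = 0" for y using van by blast
  hence "poly (coeff g k) x = 0" for k by (rule peval_eq_0_imp[rotated]) simp
  hence "[:- x, 1:] dvd coeff g k" for k by (simp add: poly_eq_0_iff_dvd)
  hence "[:[:- x, 1:]:] dvd g" by (simp add: const_poly_dvd_iff)
  thus ?thesis unfolding \<open>f = [:[:- x, 1:]:] * [:b:]\<close>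
    using ub by (metis mult_unit_dvd_iff)
qed

section \<open>Homogenisation\<close>

definition homogenize :: "nat \<Rightarrow> 'a::comm_ring_1 poly poly \<Rightarrow> 'a poly poly poly" where
  "homogenize n f = (\<Sum>k\<le>n. monom (\<Sum>j\<le>n. monom (\<Sum>i\<le>n. monom 
     (if i + j + k = n then coeff (coeff f j) i else 0) i) j) k)"

lemma coeff_sum_monom: "coeff (\<Sum>k\<le>n. monom (g k) k) m = (if m \<le> n then g m else 0)"
  by (simp add: coeff_sum)

lemma coeff3_homogenize:
  "coeff3 (homogenize n f) i j k = (if i + j + k = n then coeff (coeff f j) i else 0)"
  by (auto simp: coeff3_def homogenize_def coeff_sum_monom)

lemma is_form_homogenize: "is_form n (homogenize n f)"
  by (auto simp: is_form_def coeff3_homogenize)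

lemma poly_homogenize_1:
  assumes "\<And>i j. coeff (coeff f j) i \<noteq> 0 \<Longrightarrow> i + j \<le> n"
  shows "poly (homogenize n f) 1 = f"
proof (intro poly_eqI)
  fix i j
  have "coeff (coeff (poly (homogenize n f) 1) j) i =
    (\<Sum>k\<le>degree (homogenize n f). coeff3 (homogenize n f) i j k)"
    by (simp add: poly_altdef coeff_sum coeff3_def)
  also have "\<dots> = (\<Sum>k\<in>{..degree (homogenize n f)} \<union> {..n}. coeff3 (homogenize n f) i j k)"
    by (rule sum.mono_neutral_left) (auto simp: coeff3_def coeff_eq_0)
  also have "\<dots> = (\<Sum>k\<in>{n - (i + j)}. coeff3 (homogenize n f) i j k)"
    by (rule sum.mono_neutral_right) (auto simp: coeff3_homogenize)
  also have "\<dots> = coeff (coeff f j) i"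
    using assms[of j i] by (cases "coeff (coeff f j) i = 0") (auto simp: coeff3_homogenize)
  finally show "coeff (coeff (poly (homogenize n f) 1) j) i = coeff (coeff f j) i" .
qed

abbreviation ev2 :: "'a::comm_ring_1 poly poly \<Rightarrow> 'a \<Rightarrow> 'a \<Rightarrow> 'a" where
  "ev2 f x y \<equiv> peval (\<lambda>c. poly c x) y f"

abbreviation ev :: "'a::comm_ring_1 poly poly poly \<Rightarrow> 'a \<Rightarrow> 'a \<Rightarrow> 'a \<Rightarrow> 'a" where
  "ev F x y z \<equiv> ev3 (\<lambda>c. c) (vector [x, y, z]) F"

lemma ev_peval: "ev F x y z = peval (\<lambda>f. ev2 f x y) z F"
proof -
  have "peval (\<lambda>c. c) x = (\<lambda>c. poly c x)" for x :: 'a by (rule ext) (simp add: peval_id)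
  thus ?thesis by (simp add: ev3_def)
qed

lemma is_hom_ev2: "is_hom (\<lambda>f. ev2 f x y)"
  by (intro is_hom_peval is_hom_poly)

lemma is_hom_ev: "is_hom (\<lambda>f. ev f x y z)"
  by (intro is_hom_ev3 is_hom_id)

lemma ev_const_z: "ev F x y 1 = ev2 (poly F 1) x y" "ev F x y 0 = ev2 (poly F 0) x y"
proof -
  have "peval (\<lambda>f. ev2 f x y) (ev2 w x y) F = ev2 (poly F w) x y" for w
    using hom_peval[OF is_hom_id is_hom_ev2, of x y w F] by (simp add: peval_id)
  from this[of 1] this[of 0] show "ev F x y 1 = ev2 (poly F 1) x y" "ev F x y 0 = ev2 (poly F 0) x y"
    by (simp_all add: ev_peval is_homD[OF is_hom_ev2])
qed

lemma vec3_eq: "v = vector [v $ 1, v $ 2, v $ (3 :: 3)]"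
  by (simp add: vec_eq_iff forall_3)

lemma ev_scale:
  assumes "is_form n F"
  shows "ev F (c * x) (c * y) (c * z) = c ^ n * ev F x y z"
proof -
  have "c *s vector [x, y, z] = (vector [c * x, c * y, c * z] :: 'a ^ 3)"
    by (simp add: vec_eq_iff forall_3)
  thus ?thesis using ev3_form[OF assms is_hom_id, of c "vector [x, y, z]"] by simp
qed

lemma ev_dehom:
  fixes F :: "'a::field poly poly poly"
  assumes "is_form n F" "z \<noteq> 0"
  shows "ev F x y z = z ^ n * ev2 (poly F 1) (x / z) (y / z)"
  using ev_scale[OF assms(1), of z "x / z" "y / z" 1] assms(2) by (simp add: ev_const_z)

definition total_degree :: "'a::zero poly poly \<Rightarrow> nat" where
  "total_degree f = (GREATEST n. \<exists>i j. i + j = n \<and> coeff (coeff f j) i \<noteq> 0)"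

lemma total_degree:
  fixes f :: "'a::zero poly poly"
  assumes "f \<noteq> 0"
  shows "coeff (coeff f j) i \<noteq> 0 \<Longrightarrow> i + j \<le> total_degree f"
    "\<exists>i j. i + j = total_degree f \<and> coeff (coeff f j) i \<noteq> 0"
proof -
  let ?P = "\<lambda>n. \<exists>i j. i + j = n \<and> coeff (coeff f j) i \<noteq> 0"
  define N where "N = Max (degree ` coeff f ` {..degree f}) + degree f"
  have N: "n \<le> N" if P: "?P n" for n
  proof -
    obtain i j where ij: "i + j = n" "coeff (coeff f j) i \<noteq> 0" using P by blast
    have "coeff f j \<noteq> 0" using ij(2) by auto
    hence j: "j \<le> degree f" by (rule le_degree)
    have "i \<le> degree (coeff f j)" using ij(2) by (rule le_degree)
    also have "\<dots> \<le> Max (degree ` coeff f ` {..degree f})" using j by (intro Max_ge) auto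
    finally show ?thesis using j ij(1) by (simp add: N_def)
  qed
  show "i + j \<le> total_degree f" if "coeff (coeff f j) i \<noteq> 0" for i j
    unfolding total_degree_def by (rule Greatest_le_nat[of ?P _ N]) (use that N in auto)
  have "\<exists>n. ?P n"
    using assms by (metis leading_coeff_0_iff)
  thus "?P (total_degree f)"
    unfolding total_degree_def using GreatestI_ex_nat[of ?P N] N by blast
qed

lemma ev_eq_imp_eq:
  fixes F G :: "'a::{idom,ring_char_0} poly poly poly"
  assumes "\<And>x y z. ev F x y z = ev G x y z"
  shows "F = G"
proof -
  have "ev3 (\<lambda>c. c) v (F - G) = 0" for v
    using assms[of "v $ 1" "v $ 2" "v $ 3"] vec3_eq[of v]
    by (simp add: is_hom_diff[OF is_hom_ev3[OF is_hom_id]])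
  from ev3_eq_0_imp[OF this] show ?thesis by simp
qed

text \<open>
  Split off the powers of the variable from \<open>p\<close> and \<open>q\<close>; comparing orders at 0 and degrees leaves
  cofactors of degree 0.
\<close>

lemma factor_of_monom:
  fixes p q :: "'a::field poly"
  assumes "p * q = monom a n" "a \<noteq> 0"
  shows "\<exists>k\<le>n. p = monom (poly p 1) k"
proof -
  have nz: "p * q \<noteq> 0" using assms by (metis monom_eq_0_iff)
  hence nz': "p \<noteq> 0" "q \<noteq> 0" by auto
  obtain p' where p': "p = [:-0, 1:] ^ order 0 p * p'" "\<not> [:-0, 1:] dvd p'"
    using order_decomp[OF nz'(1)] by blast
  obtain q' where q': "q = [:-0, 1:] ^ order 0 q * q'" "\<not> [:-0, 1:] dvd q'"
    using order_decomp[OF nz'(2)] by blast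
  have x: "[:-0, 1 :: 'a:] ^ k = monom 1 k" for k by (simp add: monom_altdef)
  have "monom a n = [:-0, 1:] ^ n * [:a:]"
    unfolding x by (simp add: smult_monom mult.commute)
  moreover have "order 0 [:a:] = 0" using assms(2) by (intro order_0I) simp
  ultimately have "order 0 (monom a n) = n"
    using assms(2) order_mult[of "[:-0, 1:] ^ n" "[:a:]" 0] order_power_n_n[of "0::'a" n]
    by (metis add_0_right monom_eq_0_iff)
  hence on: "order 0 p + order 0 q = n"
    using order_mult[OF nz] assms(1) by simp
  have "degree p + degree q = n"
    using assms nz' by (metis degree_mult_eq degree_monom_eq)
  moreover have "degree p = order 0 p + degree p'"
    using nz' p'(1) by (metis degree_mult_eq degree_monom_eq x mult_zero_left mult_zero_right zero_neq_one)
  moreover have "degree q = order 0 q + degree q'"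
    using nz' q'(1) by (metis degree_mult_eq degree_monom_eq x mult_zero_left mult_zero_right zero_neq_one)
  ultimately have "degree p' = 0" using on by simp
  then obtain c where c: "p' = [:c:]" by (metis degree_eq_zeroE)
  have "p = monom c (order 0 p)"
    by (subst p'(1), unfold x c) (simp add: smult_monom mult.commute)
  moreover from this have "poly p 1 = c" by (metis poly_monom power_one mult.right_neutral)
  ultimately show ?thesis using on by (metis le_add1)
qed

text \<open>
  The restriction of a form to a line through the origin is a monomial, and a factor of a monomial
  is a monomial. This gives enough homogeneity of a factor \<open>G\<close> of a form; the exponent \<open>k\<close> may so far
  depend on the line.
\<close>

lemma ev_line_form:
  fixes G H :: "'a::field poly poly poly"
  assumes "is_form n (G * H)" "ev (G * H) x y z \<noteq> 0"
  shows "\<exists>k\<le>n. \<forall>c. ev G (c * x) (c * y) (c * z) = c ^ k * ev G x y z"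
proof -
  define L where "L = ev3 (\<lambda>c::'a. [:c:]) (vector [[:0, x:], [:0, y:], [:0, z:]])"
  have L: "poly (L F) c = ev F (c * x) (c * y) (c * z)" for F c
  proof -
    have "(\<chi> i. poly (vector [[:0, x:], [:0, y:], [:0, z:]] $ i) c) = (vector [c * x, c * y, c * z] :: 'a ^ 3)"
      by (simp add: vec_eq_iff forall_3)
    thus ?thesis
      using hom_ev3[OF is_hom_const_poly is_hom_poly, of "vector [[:0, x:], [:0, y:], [:0, z:]]" F c]
      by (simp add: L_def)
  qed
  have "L (G * H) = monom (ev (G * H) x y z) n"
  proof -
    have "(vector [[:0, x:], [:0, y:], [:0, z:]] :: 'a poly ^ 3) = [:0, 1:] *s (\<chi> i. [:vector [x, y, z] $ i:])"
      by (simp add: vec_eq_iff forall_3)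
    hence "L (G * H) = [:0, 1:] ^ n * ev3 (\<lambda>c. [:c:]) (\<chi> i. [:vector [x, y, z] $ i:]) (G * H)"
      unfolding L_def by (simp only: ev3_form[OF assms(1) is_hom_const_poly])
    also have "ev3 (\<lambda>c. [:c:]) (\<chi> i. [:vector [x, y, z] $ i:]) (G * H) = [:ev (G * H) x y z:]"
      using hom_ev3[OF is_hom_id is_hom_const_poly, of "vector [x, y, z]" "G * H"] by simp
    also have "[:0, 1:] ^ n = monom (1 :: 'a) n" by (simp add: monom_altdef)
    finally show ?thesis by (simp add: smult_monom mult.commute)
  qed
  moreover have "L (G * H) = L G * L H"
    unfolding L_def by (intro is_homD(4) is_hom_ev3 is_hom_const_poly)
  ultimately have "L G * L H = monom (ev (G * H) x y z) n" by simp
  from factor_of_monom[OF this assms(2)] obtain k where k: "k \<le> n" "L G = monom (poly (L G) 1) k"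
    by blast
  have "poly (L G) c = c ^ k * ev G x y z" for c
    by (subst k(2)) (simp add: L poly_monom)
  thus ?thesis using k(1) L by metis
qed

text \<open>
  Fix \<open>(x, y)\<close> with \<open>F(x, y, 0) \<noteq> 0\<close>, where \<open>F = G H\<close>. Scaling \<open>(x, y, z)\<close> to height 1 shows
  \<open>G(x, y, z) = c z\<^sup>k\<close> for almost all \<open>z\<close>, with finitely many possible exponents, hence with one exponent
  as polynomials in \<open>z\<close>. The value at \<open>z = 0\<close> is not 0, so \<open>k = 0\<close>.
\<close>

lemma factor_constant:
  fixes G H :: "'a::field_char_0 poly poly poly"
  assumes form: "is_form n (G * H)" and z0: "poly (G * H) 0 \<noteq> 0" and G1: "poly G 1 = [:[:c:]:]"
  shows "G = [:[:[:c:]:]:]"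
proof -
  let ?F = "G * H"
  have const: "ev G x y z = c" if nz: "ev2 (poly ?F 0) x y \<noteq> 0" for x y z
  proof -
    define g where "g = map_poly (\<lambda>f. ev2 f x y) G"
    define f where "f = map_poly (\<lambda>f. ev2 f x y) ?F"
    have pg: "poly g z = ev G x y z" for z by (simp add: g_def ev_peval peval_def)
    have pf: "poly f z = ev ?F x y z" for z by (simp add: f_def ev_peval peval_def)
    have f0: "poly f 0 \<noteq> 0" using nz by (simp add: pf ev_const_z)
    hence "f \<noteq> 0" by auto
    have g0: "poly g 0 \<noteq> 0"
      using f0 unfolding pf pg by (auto simp: is_homD[OF is_hom_ev])
    \<comment> \<open>The factors \<open>f\<close> and \<open>[:0, 1:]\<close> absorb the finitely many exceptional values of \<open>z\<close>.\<close>
    have "poly (f * [:0, 1:] * (\<Prod>k\<le>n. g - monom c k)) w = 0" for w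
    proof (cases "poly f w = 0 \<or> w = 0")
      case False
      hence w: "w \<noteq> 0" and fw: "ev ?F x y w \<noteq> 0" by (auto simp: pf)
      from ev_line_form[OF form fw] obtain k where
        k: "k \<le> n" "\<And>d. ev G (d * x) (d * y) (d * w) = d ^ k * ev G x y w" by blast
      have "c = ev G (inverse w * x) (inverse w * y) 1"
        by (simp add: ev_const_z G1 peval_pCons)
      also have "\<dots> = inverse w ^ k * ev G x y w"
        using k(2)[of "inverse w"] w by simp
      finally have "poly g w = c * w ^ k"
        unfolding pg using w by (simp add: field_simps)
      hence "poly (g - monom c k) w = 0" by (simp add: poly_monom)
      hence "poly (\<Prod>k\<le>n. g - monom c k) w = 0" using k(1) by (auto simp: poly_prod)
      thus ?thesis by simp
    qed auto
    hence "f * [:0, 1:] * (\<Prod>k\<le>n. g - monom c k) = 0"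
      using poly_all_0_iff_0 by blast
    hence "(\<Prod>k\<le>n. g - monom c k) = 0" using \<open>f \<noteq> 0\<close> by simp
    then obtain k where k: "g = monom c k" by (auto simp: prod_zero_iff)
    hence "k = 0" using g0 by (cases k) (auto simp: poly_monom)
    thus ?thesis using k pg[of z] by (simp add: poly_monom)
  qed
  have "(G - [:[:[:c:]:]:]) * [:poly ?F 0:] = 0"
  proof (rule ev_eq_imp_eq)
    fix x y z :: 'a
    have "ev [:[:[:c:]:]:] x y z = c" "ev [:poly ?F 0:] x y z = ev2 (poly ?F 0) x y"
      by (simp_all add: ev_peval peval_pCons is_homD[OF is_hom_ev2])
    thus "ev ((G - [:[:[:c:]:]:]) * [:poly ?F 0:]) x y z = ev 0 x y z"
      using const[of x y z]
      by (auto simp only: is_homD[OF is_hom_ev] is_hom_diff[OF is_hom_ev] mult_eq_0_iff right_minus_eq)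
  qed
  thus ?thesis using z0 by (simp only: mult_eq_0_iff) auto
qed

text \<open>
  A factorisation of \<open>F\<close> dehomogenises to one of \<open>F(x, y, 1)\<close>, where one factor is constant; the form is
  not divisible by \<open>z\<close>, so that factor was constant before.
\<close>

lemma irreducible_form:
  fixes F :: "'a::field_char_0 poly poly poly"
  assumes form: "is_form n F" and z0: "poly F 0 \<noteq> 0" and irr: "irreducible (poly F 1)"
  shows "irreducible F"
proof (rule irreducibleI)
  show "F \<noteq> 0" using z0 by auto
  show "\<not> is_unit F"
  proof
    assume "is_unit F"
    then obtain K where "1 = F * K" by (elim dvdE)
    hence "1 = poly F 1 * poly K 1" by (metis poly_1 poly_mult)
    thus False using irr by (metis dvd_triv_left irreducible_not_unit)
  qed
  fix G H assume F: "F = G * H"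
  have unit: "is_unit p" if pq: "is_form n (p * q)" "poly (p * q) 0 \<noteq> 0" "is_unit (poly p 1)" for p q :: "'a poly poly poly"
  proof -
    obtain c where c: "poly p 1 = [:[:c:]:]" "c dvd 1"
      using pq(3) by (auto simp: is_unit_poly_iff)
    have "p = [:[:[:c:]:]:]" by (rule factor_constant[OF pq(1,2) c(1)])
    thus ?thesis using c(2) by (simp add: is_unit_const_poly_iff)
  qed
  have "is_unit (poly G 1) \<or> is_unit (poly H 1)"
    using irr F irreducibleD by (metis poly_mult)
  thus "is_unit G \<or> is_unit H"
    using unit[of G H] unit[of H G] form z0 by (auto simp: F mult.commute)
qed

lemma dvd_of_power_z:
  fixes F G Q :: "'a::idom poly"
  assumes "poly F 0 \<noteq> 0" "[:0, 1:] ^ e * G = F * Q"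
  shows "F dvd G"
  using assms(2)
proof (induction e arbitrary: Q)
  case (Suc e)
  have "poly F 0 * poly Q 0 = poly ([:0, 1:] ^ Suc e * G) 0" by (simp only: Suc.prems poly_mult)
  hence "poly Q 0 = 0" using assms(1) by simp
  then obtain Q' where "Q = [:0, 1:] * Q'" by (metis poly_eq_0_iff_dvd dvdE neg_0_equal_iff_equal)
  hence "[:0, 1:] * ([:0, 1:] ^ e * G) = [:0, 1:] * (F * Q')"
    using Suc.prems by (simp only: power_Suc mult_ac)
  hence "[:0, 1:] ^ e * G = F * Q'" by (subst (asm) mult_left_cancel) auto
  thus ?case by (rule Suc.IH)
qed simp

text \<open>
  Homogenising \<open>G(x, y, 1) = F(x, y, 1) q(x, y)\<close> gives \<open>z\<^sup>e G = F Q\<close>, and \<open>z\<close> does not divide \<open>F\<close>.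
\<close>

lemma form_dvd_of_dehom_dvd:
  fixes F G :: "'a::field_char_0 poly poly poly"
  assumes F: "is_form n F" "poly F 0 \<noteq> 0" and G: "is_form m G" and dvd: "poly F 1 dvd poly G 1"
  shows "F dvd G"
proof -
  obtain q where q: "poly G 1 = poly F 1 * q" using dvd by (elim dvdE)
  \<comment> \<open>Homogenising \<open>q\<close> in a degree that is at least \<open>m\<close> keeps all powers of \<open>z\<close> on the side of \<open>G\<close>.\<close>
  define N where "N = total_degree q + m"
  have "i + j \<le> N" if "coeff (coeff q j) i \<noteq> 0" for i j
    using total_degree(1)[of q j i] that by (cases "q = 0") (auto simp: N_def)
  hence Q1: "poly (homogenize N q) 1 = q" by (rule poly_homogenize_1)
  let ?Q = "homogenize N q"
  define e where "e = n + total_degree q"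
  \<comment> \<open>Values can be compared for \<open>z \<noteq> 0\<close> only; the additional factor \<open>z\<close> settles \<open>z = 0\<close>.\<close>
  have "[:0, 1:] * ([:0, 1:] ^ e * G) = [:0, 1:] * (F * ?Q)"
  proof (rule ev_eq_imp_eq)
    fix x y z :: 'a
    have X: "ev [:0, 1:] x y z = z" by (simp add: ev_peval peval_pCons is_homD[OF is_hom_ev2])
    have "z * (z ^ e * ev G x y z) = z * (ev F x y z * ev ?Q x y z)"
    proof (cases "z = 0")
      case False
      have "z ^ e * ev G x y z = z ^ (e + m) * ev2 (poly F 1 * q) (x / z) (y / z)"
        by (simp add: ev_dehom[OF G False] q power_add)
      also have "\<dots> = z ^ (n + N) * (ev2 (poly F 1) (x / z) (y / z) * ev2 q (x / z) (y / z))"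
        by (simp add: is_homD[OF is_hom_ev2] e_def N_def add_ac)
      also have "\<dots> = ev F x y z * ev ?Q x y z"
        by (simp add: ev_dehom[OF F(1) False] ev_dehom[OF is_form_homogenize False] Q1 power_add)
      finally show ?thesis by simp
    qed simp
    thus "ev ([:0, 1:] * ([:0, 1:] ^ e * G)) x y z = ev ([:0, 1:] * (F * ?Q)) x y z"
      by (simp only: is_homD[OF is_hom_ev] is_hom_power[OF is_hom_ev] X)
  qed
  hence "[:0, 1:] ^ e * G = F * ?Q" by (subst (asm) mult_left_cancel) auto
  thus ?thesis using F(2) dvd_of_power_z by blast
qed

section \<open>The projective closure and its defining form\<close>

lemma proj_point_eq_iff: "proj_point v = proj_point w \<longleftrightarrow> (\<exists>c. c \<noteq> 0 \<and> w = c *s v)"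
proof
  assume "proj_point v = proj_point w"
  moreover have "w \<in> proj_point w" unfolding proj_point_def by (auto intro!: exI[of _ 1])
  ultimately show "\<exists>c. c \<noteq> 0 \<and> w = c *s v" unfolding proj_point_def by auto
next
  assume "\<exists>c. c \<noteq> 0 \<and> w = c *s v"
  then obtain c where c: "c \<noteq> 0" "w = c *s v" by blast
  have "v = inverse c *s w" using c by (simp add: vector_smult_assoc)
  show "proj_point v = proj_point w"
    unfolding proj_point_def
  proof (intro equalityI subsetI)
    fix u assume "u \<in> {d *s v |d. d \<noteq> 0}"
    then obtain d where d: "u = d *s v" "d \<noteq> 0" by blast
    have "u = (d * inverse c) *s w" using c by (simp add: d(1) vector_smult_assoc)
    moreover have "d * inverse c \<noteq> 0" using c(1) d(2) by simp
    ultimately show "u \<in> {d *s w |d. d \<noteq> 0}" by blast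
  next
    fix u assume "u \<in> {d *s w |d. d \<noteq> 0}"
    then obtain d where d: "u = d *s w" "d \<noteq> 0" by blast
    have "u = (d * c) *s v" using c by (simp add: d(1) vector_smult_assoc)
    moreover have "d * c \<noteq> 0" using c(1) d(2) by simp
    ultimately show "u \<in> {d *s v |d. d \<noteq> 0}" by blast
  qed
qed

lemma proj_zeros_iff:
  assumes "is_form n F" "v \<noteq> 0"
  shows "proj_point v \<in> proj_zeros F \<longleftrightarrow> ev3 (\<lambda>c. c) v F = 0"
proof
  assume "proj_point v \<in> proj_zeros F"
  then obtain w where w: "proj_point w = proj_point v" "eval3 F w = 0" unfolding proj_zeros_def by auto
  then obtain c where "v = c *s w" by (auto simp: proj_point_eq_iff)
  thus "ev3 (\<lambda>c. c) v F = 0" using w(2) ev3_form[OF assms(1) is_hom_id] by (simp add: eval3_eq_ev3)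
qed (use assms(2) in \<open>auto simp: proj_zeros_def eval3_eq_ev3\<close>)

lemma affine_point_eq: "affine_point (x, y) = proj_point (vector [x, y, 1])"
proof -
  have "(\<chi> i::3. if i = 1 then x else if i = 2 then y else 1) = vector [x, y, 1]"
    by (simp add: vec_eq_iff forall_3)
  thus ?thesis by (simp add: affine_point_def)
qed

text \<open>
  The homogenisation of \<open>f\<close> is one of the forms that cut out the closure; conversely every form that
  vanishes on the affine curve is divisible by it, by the Nullstellensatz. In particular the
  defining form of the closure exists.
\<close>

lemma proj_closure_eq_proj_zeros:
  fixes f :: "'a::{alg_closed_field,field_char_0} poly poly"
  assumes f: "irreducible f"
  defines "F \<equiv> homogenize (total_degree f) f"
  shows "irreducible F" "proj_closure {p. eval2 f p = 0} = proj_zeros F"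
proof -
  let ?C = "{p. eval2 f p = 0}"
  have f0: "f \<noteq> 0" using f by auto
  have F1: "poly F 1 = f"
    unfolding F_def by (rule poly_homogenize_1) (rule total_degree(1)[OF f0])
  have form: "is_form (total_degree f) F" unfolding F_def by (rule is_form_homogenize)
  obtain i j where ij: "i + j = total_degree f" "coeff (coeff f j) i \<noteq> 0"
    using total_degree(2)[OF f0] by blast
  have "coeff (coeff (poly F 0) j) i = coeff3 F i j 0"
    by (simp add: poly_0_coeff_0 coeff3_def)
  hence "coeff (coeff (poly F 0) j) i \<noteq> 0"
    using ij by (simp add: F_def coeff3_homogenize)
  hence F0: "poly F 0 \<noteq> 0" by auto
  show "irreducible F" using irreducible_form[OF form F0] f F1 by simp
  have nz: "vector [x, y, 1] \<noteq> (0 :: 'a ^ 3)" for x y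
    by (simp add: vec_eq_iff forall_3)
  have aff: "affine_point ` ?C \<subseteq> proj_zeros G \<longleftrightarrow> (\<forall>x y. ev2 f x y = 0 \<longrightarrow> ev2 (poly G 1) x y = 0)"
    if "is_form m G" for m G
  proof -
    have "affine_point (x, y) \<in> proj_zeros G \<longleftrightarrow> ev2 (poly G 1) x y = 0" for x y
      using proj_zeros_iff[OF that nz, of x y] by (simp add: affine_point_eq ev_const_z)
    thus ?thesis by (simp add: image_subset_iff eval2_eq)
  qed
  show "proj_closure ?C = proj_zeros F"
  proof
    show "proj_closure ?C \<subseteq> proj_zeros F"
      unfolding proj_closure_def using form aff[OF form] F1 by blast
    show "proj_zeros F \<subseteq> proj_closure ?C"
    proof
      fix P assume "P \<in> proj_zeros F"
      then obtain v where v: "P = proj_point v" "v \<noteq> 0" "eval3 F v = 0"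
        unfolding proj_zeros_def by blast
      have "P \<in> proj_zeros G" if G: "is_form m G" "affine_point ` ?C \<subseteq> proj_zeros G" for m G
      proof -
        have "f dvd poly G 1"
          using aff[OF G(1)] G(2) by (intro plane_nullstellensatz[OF f]) blast
        hence "F dvd G" by (intro form_dvd_of_dehom_dvd[OF form F0 G(1)]) (simp add: F1)
        then obtain Q where "G = F * Q" by (elim dvdE)
        hence "ev3 (\<lambda>c. c) v G = 0"
          using v(3) by (simp add: eval3_eq_ev3 is_homD[OF is_hom_ev3[OF is_hom_id]])
        thus ?thesis using proj_zeros_iff[OF G(1) v(2)] v(1) by simp
      qed
      moreover have "P \<in> proj_space" using v by (auto simp: proj_space_def)
      ultimately show "P \<in> proj_closure ?C" unfolding proj_closure_def by blast
    qed
  qed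
qed

lemma defining_form:
  fixes C :: "('a::{alg_closed_field,field_char_0} \<times> 'a) set"
  assumes "irreducible_affine_curve C"
  defines "D \<equiv> defining_form (proj_closure C)" and "d \<equiv> curve_degree (proj_closure C)"
  shows "irreducible D" "is_form d D" "proj_closure C = proj_zeros D"
proof -
  obtain f where f: "irreducible f" "C = {p. eval2 f p = 0}"
    using assms(1) by (auto simp: irreducible_affine_curve_def)
  have "\<exists>F. irreducible F \<and> (\<exists>n. is_form n F) \<and> proj_closure C = proj_zeros F"
    using proj_closure_eq_proj_zeros[OF f(1)] is_form_homogenize f(2) by blast
  from someI_ex[OF this] have D: "irreducible D" "\<exists>n. is_form n D" "proj_closure C = proj_zeros D"
    by (auto simp: D_def defining_form_def)
  show "irreducible D" "proj_closure C = proj_zeros D" by fact+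
  have "D \<noteq> 0" using D(1) by auto
  then obtain i j k where ijk: "coeff3 D i j k \<noteq> 0"
    unfolding coeff3_def by (metis leading_coeff_0_iff)
  obtain n where n: "is_form n D" using D(2) by blast
  have "m = n" if "is_form m D" for m
    using that n ijk unfolding is_form_def by metis
  hence "d = n" using n unfolding d_def curve_degree_def D_def[symmetric] by blast
  thus "is_form d D" using n by simp
qed

text \<open>
  A form vanishing on a line is divisible by the linear form of that line. To divide, solve
  \<open>l = 0\<close> for the outermost variable that occurs in \<open>l\<close>.
\<close>

lemma irreducible_vanishing_on_line:
  fixes D :: "'a::field_char_0 poly poly poly" and l :: "'a ^ 3"
  assumes irr: "irreducible D" and l: "l \<noteq> 0"
    and van: "\<And>v. linear_form l v = 0 \<Longrightarrow> ev3 (\<lambda>c. c) v D = 0"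
  shows "\<exists>c. c \<noteq> 0 \<and> (\<forall>v. ev3 (\<lambda>c. c) v D = c * linear_form l v)"
proof -
  define a b g where "a = l $ 1" and "b = l $ 2" and "g = l $ 3"
  \<comment> \<open>The linear form \<open>a x + b y + g z\<close>.\<close>
  define p where "p = [:[:[:0, a:], [:b:]:], [:[:g:]:]:]"
  have lf: "linear_form l v = a * v $ 1 + b * v $ 2 + g * v $ 3" for v
    by (simp add: linear_form_def sum_3 a_def b_def g_def)
  have pv: "ev3 (\<lambda>c. c) v p = linear_form l v" for v
    by (simp add: p_def lf ev3_def peval_pCons algebra_simps)
  have van': "ev D x y z = 0" if "a * x + b * y + g * z = 0" for x y z
    by (rule van) (use that in \<open>simp add: lf\<close>)
  have "p dvd D"
  proof -
    consider "g \<noteq> 0" | "g = 0" "b \<noteq> 0" | "g = 0" "b = 0" "a \<noteq> 0"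
      using l by (auto simp: vec_eq_iff forall_3 a_def b_def g_def)
    thus ?thesis
    proof cases
      case 1
      define w where "w = [:[:0, - a / g:], [:- b / g:]:]"
      have w: "ev2 w x y = - (a * x + b * y) / g" for x y
        by (simp add: w_def peval_pCons) (use 1 in \<open>simp add: field_simps\<close>)
      have "ev2 (poly D w) x y = 0" for x y
      proof -
        have "ev2 (poly D w) x y = ev D x y (ev2 w x y)"
          using hom_peval[OF is_hom_id is_hom_ev2, of x y w D] by (simp add: peval_id ev_peval)
        thus ?thesis using van' 1 by (simp add: w field_simps)
      qed
      hence "poly D w = 0" by (rule ev2_eq_0_imp)
      then obtain q where q: "D = [:- w, 1:] * q" by (metis poly_eq_0_iff_dvd dvdE)
      have "[:- w, 1:] = p * [:[:[:1 / g:]:]:]"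
        using 1 by (simp add: p_def w_def one_pCons)
      hence "D = p * ([:[:[:1 / g:]:]:] * q)" unfolding q by (simp only: mult.assoc)
      thus ?thesis by (rule dvdI)
    next
      case 2
      define w where "w = [:0, - a / b:]"
      have "poly (coeff D k) w = 0" for k
      proof -
        have "poly (poly (coeff D k) w) x = 0" for x
        proof -
          have "ev2 (coeff D k) x (poly w x) = 0"
          proof (rule peval_eq_0_imp[where h = "\<lambda>f. ev2 f x (poly w x)"])
            show "peval (\<lambda>f. ev2 f x (poly w x)) z D = 0" for z
              unfolding ev_peval[symmetric] by (rule van') (use 2 in \<open>simp add: w_def\<close>)
          qed simp
          thus ?thesis
            using hom_peval[OF is_hom_id is_hom_poly[of x], of w "coeff D k"] by (simp add: peval_id)
        qed
        thus ?thesis using poly_all_0_iff_0 by blast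
      qed
      hence "[:- w, 1:] dvd coeff D k" for k by (simp add: poly_eq_0_iff_dvd)
      hence "[:[:- w, 1:]:] dvd D" by (simp add: const_poly_dvd_iff)
      then obtain q where q: "D = [:[:- w, 1:]:] * q" by (elim dvdE)
      have "[:[:- w, 1:]:] = p * [:[:[:1 / b:]:]:]"
        using 2 by (simp add: p_def w_def one_pCons)
      hence "D = p * ([:[:[:1 / b:]:]:] * q)" unfolding q by (simp only: mult.assoc)
      thus ?thesis by (rule dvdI)
    next
      case 3
      have "poly (coeff (coeff D k) j) 0 = 0" for k j
      proof -
        have "ev2 (coeff D k) 0 y = 0" for y
        proof (rule peval_eq_0_imp[where h = "\<lambda>f. ev2 f 0 y"])
          show "peval (\<lambda>f. ev2 f 0 y) z D = 0" for z
            unfolding ev_peval[symmetric] by (rule van') (use 3 in simp)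
        qed simp
        thus ?thesis by (rule peval_eq_0_imp[rotated]) simp
      qed
      hence "[:0, 1:] dvd coeff (coeff D k) j" for k j by (simp add: poly_eq_0_iff_dvd)
      hence "[:[:[:0, 1:]:]:] dvd D" by (simp add: const_poly_dvd_iff)
      then obtain q where q: "D = [:[:[:0, 1:]:]:] * q" by (elim dvdE)
      have "[:[:[:0, 1:]:]:] = p * [:[:[:1 / a:]:]:]"
        using 3 by (simp add: p_def one_pCons)
      hence "D = p * ([:[:[:1 / a:]:]:] * q)" unfolding q by (simp only: mult.assoc)
      thus ?thesis by (rule dvdI)
    qed
  qed
  then obtain q where q: "D = p * q" by (elim dvdE)
  have "\<not> is_unit p"
  proof
    assume "is_unit p"
    then obtain k where "1 = p * k" by (elim dvdE)
    hence "ev3 (\<lambda>c. c) 0 1 = ev3 (\<lambda>c. c) 0 p * ev3 (\<lambda>c. c) 0 k"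
      by (metis is_homD(4) is_hom_ev3 is_hom_id)
    thus False by (simp add: pv lf is_homD[OF is_hom_ev3[OF is_hom_id]])
  qed
  hence "is_unit q" using irr q irreducibleD by blast
  then obtain c where c: "q = [:[:[:c:]:]:]" "c \<noteq> 0"
    by (auto simp: is_unit_poly_iff dvd_field_iff)
  have "ev3 (\<lambda>c. c) v D = c * linear_form l v" for v
    unfolding q by (simp add: is_homD[OF is_hom_ev3[OF is_hom_id]] pv)
       (simp add: c(1) ev3_def peval_pCons)
  thus ?thesis using c(2) by blast
qed

section \<open>Root towers\<close>

lemma is_hom_to_ac: "is_hom to_ac"
  by (simp add: is_hom_def)

lemma is_hom_to_fract: "is_hom to_fract"
  by (simp add: is_hom_def)

lemma is_hom_emb: "is_hom (\<lambda>a. to_ac (to_fract a))"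
  by (rule is_hom_comp[OF is_hom_to_fract is_hom_to_ac])

lemma is_hom_const: "is_hom const"
  using is_hom_comp[OF is_hom_const_poly is_hom_emb] by (simp add: const_def[abs_def])

lemma const_eq_0_iff [simp]: "const c = 0 \<longleftrightarrow> c = 0"
  by (simp add: const_def)

lemma kbar_numeral_neq_0: "(numeral n :: 'a::field_char_0 kbar) \<noteq> 0"
proof -
  have "const (of_nat (numeral n) :: 'a) = (of_nat (numeral n) :: 'a kbar)"
    by (rule is_hom_of_nat[OF is_hom_const])
  thus ?thesis by (metis const_eq_0_iff of_nat_numeral zero_neq_numeral)
qed

definition is_subfield :: "'b::field set \<Rightarrow> bool" where
  "is_subfield E \<longleftrightarrow> 1 \<in> E \<and> (\<forall>x\<in>E. - x \<in> E \<and> inverse x \<in> E) \<and> (\<forall>x\<in>E. \<forall>y\<in>E. x + y \<in> E \<and> x * y \<in> E)"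

lemma is_subfieldD:
  assumes "is_subfield E"
  shows "1 \<in> E" "0 \<in> E" "x \<in> E \<Longrightarrow> - x \<in> E" "x \<in> E \<Longrightarrow> inverse x \<in> E"
    "x \<in> E \<Longrightarrow> y \<in> E \<Longrightarrow> x + y \<in> E" "x \<in> E \<Longrightarrow> y \<in> E \<Longrightarrow> x * y \<in> E"
    "x \<in> E \<Longrightarrow> y \<in> E \<Longrightarrow> x - y \<in> E" "x \<in> E \<Longrightarrow> y \<in> E \<Longrightarrow> x / y \<in> E" "x \<in> E \<Longrightarrow> x ^ n \<in> E"
proof -
  have *: "1 \<in> E" "x \<in> E \<Longrightarrow> - x \<in> E" "x \<in> E \<Longrightarrow> inverse x \<in> E"
    "x \<in> E \<Longrightarrow> y \<in> E \<Longrightarrow> x + y \<in> E" "x \<in> E \<Longrightarrow> y \<in> E \<Longrightarrow> x * y \<in> E" for x y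
    using assms by (auto simp: is_subfield_def)
  show "1 \<in> E" "x \<in> E \<Longrightarrow> - x \<in> E" "x \<in> E \<Longrightarrow> inverse x \<in> E"
    "x \<in> E \<Longrightarrow> y \<in> E \<Longrightarrow> x + y \<in> E" "x \<in> E \<Longrightarrow> y \<in> E \<Longrightarrow> x * y \<in> E" by (fact *)+
  show "0 \<in> E" using *(4)[OF *(1) *(2)[OF *(1)]] by simp
  show "x \<in> E \<Longrightarrow> y \<in> E \<Longrightarrow> x - y \<in> E" using *(4)[OF _ *(2)] by simp
  show "x \<in> E \<Longrightarrow> y \<in> E \<Longrightarrow> x / y \<in> E" using *(5)[OF _ *(3)] by (simp add: divide_inverse)
  show "x \<in> E \<Longrightarrow> x ^ n \<in> E" by (induction n) (simp_all add: *)
qed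

lemma is_subfield_range_to_ac: "is_subfield (range to_ac)"
proof -
  have "1 \<in> range to_ac" using to_ac_1 by (metis rangeI)
  moreover have "- to_ac x \<in> range to_ac" "inverse (to_ac x) \<in> range to_ac"
    "to_ac x + to_ac y \<in> range to_ac" "to_ac x * to_ac y \<in> range to_ac" for x y :: 'a
    by (metis rangeI to_ac_minus, metis rangeI to_ac_inverse, metis rangeI to_ac_add, metis rangeI to_ac_mult)
  ultimately show ?thesis unfolding is_subfield_def by blast
qed

lemma ring_of_type_algebra_simps:
  "\<zero>\<^bsub>ring_of_type_algebra\<^esub> = (0 :: 'b::field)" "\<one>\<^bsub>ring_of_type_algebra\<^esub> = (1 :: 'b)"
  "x \<oplus>\<^bsub>ring_of_type_algebra\<^esub> y = (x + y :: 'b)" "x \<otimes>\<^bsub>ring_of_type_algebra\<^esub> y = (x * y :: 'b)"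
  "\<ominus>\<^bsub>ring_of_type_algebra\<^esub> x = (- x :: 'b)"
  "x \<noteq> 0 \<Longrightarrow> inv\<^bsub>ring_of_type_algebra\<^esub> x = (inverse x :: 'b)"
  "carrier ring_of_type_algebra = (UNIV :: 'b set)"
proof -
  let ?R = "ring_of_type_algebra :: 'b ring"
  interpret R: field ?R by rule
  show *: "\<zero>\<^bsub>?R\<^esub> = 0" "\<one>\<^bsub>?R\<^esub> = 1" "x \<oplus>\<^bsub>?R\<^esub> y = x + y" "x \<otimes>\<^bsub>?R\<^esub> y = x * y" "carrier ?R = UNIV" for x y
    by (simp_all add: ring_of_type_algebra_def)
  show "\<ominus>\<^bsub>?R\<^esub> x = - x" by (rule R.minus_equality) (simp_all add: *)
  show "inv\<^bsub>?R\<^esub> x = inverse x" if "x \<noteq> 0" by (rule R.comm_inv_char) (use that in \<open>simp_all add: *\<close>)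
qed

lemma is_subfield_generate_field: "is_subfield (generate_field ring_of_type_algebra H)"
proof -
  let ?R = "ring_of_type_algebra :: 'a ring" and ?G = "generate_field (ring_of_type_algebra :: 'a ring) H"
  have 1: "1 \<in> ?G" using generate_field.one[of ?R H] by (simp add: ring_of_type_algebra_simps)
  have neg: "- x \<in> ?G" if "x \<in> ?G" for x using generate_field.a_inv[OF that] by (simp add: ring_of_type_algebra_simps)
  have add: "x + y \<in> ?G" if "x \<in> ?G" "y \<in> ?G" for x y
    using generate_field.eng_add[OF that] by (simp add: ring_of_type_algebra_simps)
  have mult: "x * y \<in> ?G" if "x \<in> ?G" "y \<in> ?G" for x y
    using generate_field.eng_mult[OF that] by (simp add: ring_of_type_algebra_simps)
  have inv: "inverse x \<in> ?G" if "x \<in> ?G" for x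
    using generate_field.m_inv[OF that] that by (cases "x = 0") (simp_all add: ring_of_type_algebra_simps)
  show ?thesis unfolding is_subfield_def by (simp add: 1 neg add mult inv)
qed

lemma generate_field_least:
  assumes "is_subfield E" "H \<subseteq> E"
  shows "generate_field ring_of_type_algebra H \<subseteq> E"
proof
  fix x assume "x \<in> generate_field ring_of_type_algebra H"
  thus "x \<in> E"
    by induction (use assms in \<open>auto simp: ring_of_type_algebra_simps intro: is_subfieldD\<close>)
qed

lemma splitting_field_base: "E \<subseteq> splitting_field E p"
proof
  fix x assume "x \<in> E"
  thus "x \<in> splitting_field E p" unfolding splitting_field_def by (intro generate_field.incl UnI1)
qed

lemma splitting_field_root:
  assumes "poly p x = 0"
  shows "x \<in> splitting_field E p"
  unfolding splitting_field_def by (rule generate_field.incl, rule UnI2, rule CollectI, rule assms)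

text \<open>
  The last field of a root tower. Only the tower matters for the parametrization, so it is taken as
  a tower for the polynomial 1, which has no roots.
\<close>

definition radical_extension :: "'a::field kbar set \<Rightarrow> bool" where
  "radical_extension E \<longleftrightarrow> (\<exists>Ks. root_tower 1 Ks \<and> last Ks = E)"

lemma splitting_field_one:
  "splitting_field (range to_ac) (map_poly to_ac (1 :: 'a::field poly fract poly)) \<subseteq> range to_ac"
proof -
  have "map_poly to_ac (1 :: 'a poly fract poly) = 1" by (rule map_poly_1') (rule to_ac_1)
  hence "{x. poly (map_poly to_ac (1 :: 'a poly fract poly)) x = 0} = {}" by simp
  thus ?thesis
    unfolding splitting_field_def
    by (intro generate_field_least[OF is_subfield_range_to_ac]) (simp only: Un_empty_right order_refl)
qed

lemma radical_extension_base: "radical_extension (range to_ac :: 'a::field kbar set)"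
  unfolding radical_extension_def root_tower_def
proof (intro exI[of _ "[range to_ac]"] conjI)
  show "splitting_field (range to_ac) (map_poly to_ac (1 :: 'a poly fract poly)) \<subseteq> last [range to_ac]"
    using splitting_field_one by (simp only: last.simps if_True simp_thms)
qed simp_all

text \<open>
  The last field is either the base field or a splitting field, that is, a generated field.
\<close>

lemma radical_extension_is_subfield:
  assumes "radical_extension E"
  shows "is_subfield E"
proof -
  obtain Ks where Ks: "root_tower 1 Ks" "last Ks = E" using assms by (auto simp: radical_extension_def)
  have "Ks \<noteq> []" "hd Ks = range to_ac" using Ks(1) by (auto simp: root_tower_def)
  show ?thesis
  proof (cases "length Ks = 1")
    case True
    thus ?thesis using \<open>hd Ks = range to_ac\<close> Ks(2) is_subfield_range_to_ac
      by (cases Ks) auto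
  next
    case False
    hence l: "Suc (length Ks - 2) < length Ks" using \<open>Ks \<noteq> []\<close> by (cases Ks) auto
    moreover have "Suc (length Ks - 2) = length Ks - 1" using l by linarith
    ultimately obtain p K where "Ks ! (length Ks - 1) = splitting_field K p"
      using Ks(1) unfolding root_tower_def by metis
    hence "E = splitting_field K p"
      using Ks(2) \<open>Ks \<noteq> []\<close> by (simp add: last_conv_nth)
    thus ?thesis by (simp add: splitting_field_def is_subfield_generate_field)
  qed
qed

lemma radical_extension_base_subset:
  fixes E :: "'a::field kbar set"
  assumes "radical_extension E"
  shows "range to_ac \<subseteq> E"
proof -
  obtain Ks where Ks: "root_tower (1 :: 'a poly fract poly) Ks" "last Ks = E"
    using assms by (auto simp: radical_extension_def)
  have "splitting_field (range to_ac) (map_poly to_ac (1 :: 'a poly fract poly)) \<subseteq> last Ks"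
    using Ks(1) unfolding root_tower_def by blast
  from subset_trans[OF splitting_field_base this] show ?thesis unfolding Ks(2) .
qed

text \<open>
  The next step of the tower is the splitting field of \<open>X\<^sup>l - x\<^sup>l\<close>; it contains every \<open>l\<close>-th root of
  \<open>x\<^sup>l\<close>, so no root of unity has to be adjoined separately.
\<close>

lemma radical_extension_root:
  assumes E: "radical_extension E" and "l > 0" and x: "x ^ l \<in> E"
  shows "\<exists>E'. radical_extension E' \<and> E \<subseteq> E' \<and> x \<in> E'"
proof (cases "x = 0")
  case True
  thus ?thesis using E is_subfieldD(2)[OF radical_extension_is_subfield[OF E]] by auto
next
  case False
  obtain Ks where Ks: "root_tower 1 Ks" "last Ks = E" using E by (auto simp: radical_extension_def)
  have ne: "Ks \<noteq> []" using Ks(1) by (auto simp: root_tower_def)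
  define E' where "E' = splitting_field E (Polynomial.monom 1 l - [:x ^ l:])"
  have sub: "E \<subseteq> E'" and x': "x \<in> E'"
    unfolding E'_def by (rule splitting_field_base, rule splitting_field_root) (simp add: poly_monom)
  have "root_tower 1 (Ks @ [E'])"
    unfolding root_tower_def
  proof (intro conjI allI impI)
    fix i assume i: "Suc i < length (Ks @ [E'])"
    show "\<exists>l a. l > 0 \<and> a \<in> (Ks @ [E']) ! i \<and> a \<noteq> 0 \<and>
      (Ks @ [E']) ! Suc i = splitting_field ((Ks @ [E']) ! i) (Polynomial.monom 1 l - [:a:])"
    proof (cases "Suc i < length Ks")
      case True
      thus ?thesis using Ks(1) unfolding root_tower_def by (simp add: nth_append)
    next
      case False
      hence i': "i = length Ks - 1" "Suc i = length Ks" using i ne by (auto simp: neq_Nil_conv)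
      hence *: "(Ks @ [E']) ! i = E" "(Ks @ [E']) ! Suc i = E'"
        using ne Ks(2) by (simp_all add: nth_append last_conv_nth)
      show ?thesis unfolding * using \<open>l > 0\<close> x \<open>x \<noteq> 0\<close> E'_def
        by (intro exI[of _ l] exI[of _ "x ^ l"]) auto
    qed
  qed (use Ks ne sub in \<open>auto simp: root_tower_def\<close>)
  hence "radical_extension E'" unfolding radical_extension_def by auto
  thus ?thesis using sub x' by blast
qed

lemma numeral_mem_radical_extension:
  assumes "radical_extension E"
  shows "numeral n \<in> E"
proof -
  have "to_ac (numeral n) \<in> E" by (rule subsetD[OF radical_extension_base_subset[OF assms] rangeI])
  thus ?thesis unfolding to_ac_numeral .
qed

lemmas radical_mem = is_subfieldD[OF radical_extension_is_subfield] numeral_mem_radical_extension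

section \<open>Equations of degree at most four\<close>

lemma quadratic_completion:
  fixes x b c :: "'b::comm_ring_1"
  assumes "x ^ 2 + b * x + c = 0"
  shows "(2 * x + b) ^ 2 = b ^ 2 - 4 * c"
proof -
  have "(2 * x + b) ^ 2 = b ^ 2 - 4 * c + 4 * (x ^ 2 + b * x + c)"
    by (simp add: algebra_simps power2_eq_square)
  thus ?thesis by (simp add: assms)
qed

lemma vieta_substitution:
  fixes z y q :: "'b::comm_ring_1"
  shows "(z ^ 3) ^ 2 + q * z ^ 3 + (- ((z ^ 2 - y * z) ^ 3)) = z ^ 3 * (y ^ 3 + 3 * (z ^ 2 - y * z) * y + q)"
  by (simp add: algebra_simps power2_eq_square power3_eq_cube)

lemma cubic_completion:
  fixes x A u c :: "'b::comm_ring_1"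
  shows "(x + A) ^ 3 + 3 * u * (x + A) + (c - A * (3 * (u + A ^ 2)) + 2 * A ^ 3) =
     x ^ 3 + 3 * A * x ^ 2 + 3 * (u + A ^ 2) * x + c"
  by (simp add: algebra_simps power2_eq_square power3_eq_cube)

lemma quartic_completion:
  fixes x A b c e :: "'b::comm_ring_1"
  shows "(x + A) ^ 4 + (b - 6 * A ^ 2) * (x + A) ^ 2 + (c - 2 * A * b + 8 * A ^ 3) * (x + A) +
      (e - A * c + A ^ 2 * b - 3 * A ^ 4) = x ^ 4 + 4 * A * x ^ 3 + b * x ^ 2 + c * x + e"
  by (simp add: algebra_simps power2_eq_square power3_eq_cube power4_eq_xxxx)

lemma ferrari_resolvent:
  fixes N n t p r :: "'b::comm_ring_1"
  assumes "N ^ 3 + 2 * p * N ^ 2 + (p ^ 2 - 4 * r) * N + - ((n * t) ^ 2) = 0" "n ^ 2 = N"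
  shows "N * (4 * r) = N * ((p + N) ^ 2 - t ^ 2)"
proof -
  have "N * ((p + N) ^ 2 - t ^ 2) = N * (4 * r) + (N ^ 3 + 2 * p * N ^ 2 + (p ^ 2 - 4 * r) * N + - ((n * t) ^ 2))"
    unfolding assms(2)[symmetric] by (simp add: algebra_simps power2_eq_square power3_eq_cube)
  thus ?thesis unfolding assms(1) by simp
qed

lemma ferrari_factorization:
  fixes N n t p r k k' y :: "'b::comm_ring_1"
  assumes "4 * r = (2 * k) * (2 * k')" "2 * k = p + N - t" "2 * k' = p + N + t" "n ^ 2 = N"
  shows "4 * ((y ^ 2 + n * y + k) * (y ^ 2 + (- n) * y + k')) = 4 * (y ^ 4 + p * y ^ 2 + (n * t) * y + r)"
proof -
  have "4 * ((y ^ 2 + n * y + k) * (y ^ 2 + (- n) * y + k')) =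
      (2 * y ^ 2 + 2 * n * y + 2 * k) * (2 * y ^ 2 - 2 * n * y + 2 * k')"
    by (simp add: algebra_simps)
  also have "\<dots> = 4 * y ^ 4 + 4 * p * y ^ 2 + 4 * (n * t) * y + (2 * k) * (2 * k')"
    unfolding assms(2,3) assms(4)[symmetric]
    by (simp add: algebra_simps power2_eq_square power4_eq_xxxx)
  also have "\<dots> = 4 * (y ^ 4 + p * y ^ 2 + (n * t) * y + r)"
    unfolding assms(1)[symmetric] by (simp add: algebra_simps)
  finally show ?thesis .
qed

lemma quadratic_radical:
  fixes x :: "'a::field_char_0 kbar"
  assumes E: "radical_extension E" and "b \<in> E" "c \<in> E" and "x ^ 2 + b * x + c = 0"
  shows "\<exists>E'. radical_extension E' \<and> E \<subseteq> E' \<and> x \<in> E'"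
proof -
  have "(2 * x + b) ^ 2 = b ^ 2 - 4 * c" by (rule quadratic_completion[OF assms(4)])
  hence "(2 * x + b) ^ 2 \<in> E" using assms by (simp add: radical_mem[OF E])
  then obtain E' where E': "radical_extension E'" "E \<subseteq> E'" "2 * x + b \<in> E'"
    using radical_extension_root[OF E, of 2] by auto
  have "x = ((2 * x + b) - b) / 2" using kbar_numeral_neq_0[where 'a='a] by simp
  moreover have "((2 * x + b) - b) / 2 \<in> E'"
    using radical_mem(8)[OF E'(1) radical_mem(7)[OF E'(1) E'(3)] radical_mem(10)[OF E'(1)]] assms(2) E'(2)
    by (meson subsetD)
  ultimately have "x \<in> E'" by simp
  thus ?thesis using E' by metis
qed

text \<open>
  Cardano's formula read backwards, so that no choice of roots has to be justified: for the given
  root \<open>y\<close> pick \<open>z\<close> with \<open>y = z - u / z\<close>. Then \<open>z\<^sup>3\<close> is a root of a quadratic equation with known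
  coefficients.
\<close>

lemma depressed_cubic_radical:
  fixes y :: "'a::field_char_0 kbar"
  assumes E: "radical_extension E" and u: "u \<in> E" and q: "q \<in> E" and y: "y ^ 3 + 3 * u * y + q = 0"
  shows "\<exists>E'. radical_extension E' \<and> E \<subseteq> E' \<and> y \<in> E'"
proof -
  obtain z where "poly [:- u, - y, 1:] z = 0"
    using alg_closed_imp_poly_has_root[of "[:- u, - y, 1:]"] by auto
  hence z: "u = z ^ 2 - y * z" by (simp add: algebra_simps power2_eq_square)
  have "(z ^ 3) ^ 2 + q * z ^ 3 + (- (u ^ 3)) = z ^ 3 * (y ^ 3 + 3 * u * y + q)"
    unfolding z by (rule vieta_substitution)
  hence "(z ^ 3) ^ 2 + q * z ^ 3 + (- (u ^ 3)) = 0" using y by simp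
  then obtain E1 where E1: "radical_extension E1" "E \<subseteq> E1" "z ^ 3 \<in> E1"
    using quadratic_radical[OF E q radical_mem(3)[OF E radical_mem(9)[OF E u]], of "z ^ 3" 3] by auto
  then obtain E2 where E2: "radical_extension E2" "E1 \<subseteq> E2" "z \<in> E2"
    using radical_extension_root[OF E1(1), of 3 z] by auto
  show ?thesis
  proof (cases "z = 0")
    case True
    hence "y ^ 3 = - q" using y z by (simp add: eq_neg_iff_add_eq_0)
    hence "y ^ 3 \<in> E" using q by (simp add: radical_mem[OF E])
    thus ?thesis using radical_extension_root[OF E, of 3 y] by auto
  next
    case False
    hence "y = (z ^ 2 - u) / z" unfolding z by (simp add: field_simps power2_eq_square)
    moreover have "(z ^ 2 - u) / z \<in> E2"
      using radical_mem(8)[OF E2(1) radical_mem(7)[OF E2(1) radical_mem(9)[OF E2(1) E2(3)]] E2(3)] u E1(2) E2(2)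
      by (meson subsetD)
    ultimately have "y \<in> E2" by simp
    thus ?thesis using E1(2) E2(1,2) by (meson order_trans)
  qed
qed

lemma cubic_radical:
  fixes x :: "'a::field_char_0 kbar"
  assumes E: "radical_extension E" and abc: "a \<in> E" "b \<in> E" "c \<in> E"
    and x: "x ^ 3 + a * x ^ 2 + b * x + c = 0"
  shows "\<exists>E'. radical_extension E' \<and> E \<subseteq> E' \<and> x \<in> E'"
proof -
  define A where "A = a / 3"
  define u where "u = b / 3 - A ^ 2"
  define q where "q = c - A * b + 2 * A ^ 3"
  have n: "(3 :: 'a kbar) \<noteq> 0" by (rule kbar_numeral_neq_0)
  have a: "a = 3 * A" and b: "b = 3 * (u + A ^ 2)" using n by (simp_all add: A_def u_def)
  have mem: "A \<in> E" "u \<in> E" "q \<in> E"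
    unfolding q_def u_def A_def using abc by (auto intro!: radical_mem[OF E])
  have "(x + A) ^ 3 + 3 * u * (x + A) + q = x ^ 3 + a * x ^ 2 + b * x + c"
    unfolding q_def a b by (rule cubic_completion)
  then obtain E' where E': "radical_extension E'" "E \<subseteq> E'" "x + A \<in> E'"
    using depressed_cubic_radical[OF E mem(2,3), of "x + A"] x by auto
  have "(x + A) - A \<in> E'" using radical_mem(7)[OF E'(1) E'(3)] mem(1) E'(2) by (meson subsetD)
  thus ?thesis using E' by auto
qed

text \<open>
  The factorisation \<open>(y\<^sup>2 + n y + k) (y\<^sup>2 - n y + k')\<close> of the quartic: \<open>N = n\<^sup>2\<close> is a root of the resolvent
  cubic, \<open>n\<close> is a square root, \<open>k\<close> and \<open>k'\<close> are rational in \<open>n\<close>, and the given root is a root of one of the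
  two quadratic factors. If \<open>N = 0\<close>, the quartic is quadratic in \<open>y\<^sup>2\<close>.
\<close>

lemma depressed_quartic_radical:
  fixes y :: "'a::field_char_0 kbar"
  assumes E: "radical_extension E" and pqr: "p \<in> E" "q \<in> E" "r \<in> E"
    and y: "y ^ 4 + p * y ^ 2 + q * y + r = 0"
  shows "\<exists>E'. radical_extension E' \<and> E \<subseteq> E' \<and> y \<in> E'"
proof -
  define b c where "b = p ^ 2 - 4 * r" and "c = - (q ^ 2)"
  \<comment> \<open>The resolvent cubic.\<close>
  obtain N where "poly [:c, b, 2 * p, 1:] N = 0"
    using alg_closed_imp_poly_has_root[of "[:c, b, 2 * p, 1:]"] by auto
  hence N: "N ^ 3 + 2 * p * N ^ 2 + b * N + c = 0"
    by (simp add: algebra_simps power2_eq_square power3_eq_cube)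
  have "2 * p \<in> E" "b \<in> E" "c \<in> E"
    unfolding b_def c_def using pqr by (auto intro!: radical_mem[OF E])
  from cubic_radical[OF E this N] obtain E1 where
    E1: "radical_extension E1" "E \<subseteq> E1" "N \<in> E1" by blast
  obtain n where n: "n ^ 2 = N" using nth_root_exists[of 2 N] by auto
  then obtain E2 where E2: "radical_extension E2" "E1 \<subseteq> E2" "n \<in> E2"
    using radical_extension_root[OF E1(1), of 2 n] E1(3) by auto
  have mem: "p \<in> E2" "q \<in> E2" "r \<in> E2" "N \<in> E2" using pqr E1 E2 by auto
  have sub: "E \<subseteq> E2" using E1 E2 by auto
  show ?thesis
  proof (cases "n = 0")
    case True
    hence "q = 0" using n N by (simp add: c_def)
    hence "(y ^ 2) ^ 2 + p * y ^ 2 + r = 0" using y by (simp flip: power_mult)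
    from quadratic_radical[OF E pqr(1,3) this] obtain E3 where
      E3: "radical_extension E3" "E \<subseteq> E3" "y ^ 2 \<in> E3" by blast
    thus ?thesis using radical_extension_root[OF E3(1), of 2 y] by auto
  next
    case False
    define t where "t = q / n"
    define k k' where "k = (p + N - t) / 2" and "k' = (p + N + t) / 2"
    have qt: "q = n * t" using False by (simp add: t_def)
    have two: "(2 :: 'a kbar) \<noteq> 0" by (rule kbar_numeral_neq_0)
    have kk: "2 * k = p + N - t" "2 * k' = p + N + t" using two by (simp_all add: k_def k'_def)
    have "N * (4 * r) = N * ((p + N) ^ 2 - t ^ 2)"
      using ferrari_resolvent[OF _ n] N unfolding b_def c_def qt by blast
    moreover have "N \<noteq> 0" using n False by auto
    ultimately have "4 * r = (p + N) ^ 2 - t ^ 2" by (metis mult_left_cancel)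
    hence r: "4 * r = (2 * k) * (2 * k')" unfolding kk by (simp add: power2_eq_square algebra_simps)
    have "4 * ((y ^ 2 + n * y + k) * (y ^ 2 + (- n) * y + k')) = 4 * (y ^ 4 + p * y ^ 2 + q * y + r)"
      unfolding qt by (rule ferrari_factorization[OF r kk n])
    hence "4 * ((y ^ 2 + n * y + k) * (y ^ 2 + (- n) * y + k')) = 0" using y by simp
    hence "y ^ 2 + n * y + k = 0 \<or> y ^ 2 + (- n) * y + k' = 0"
      using kbar_numeral_neq_0[where 'a='a] by simp
    moreover have "k \<in> E2" "k' \<in> E2" "- n \<in> E2"
      unfolding k_def k'_def t_def using mem E2 by (auto intro!: radical_mem[OF E2(1)])
    ultimately obtain E3 where "radical_extension E3" "E2 \<subseteq> E3" "y \<in> E3"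
      using quadratic_radical[OF E2(1), of n k y] quadratic_radical[OF E2(1), of "- n" k' y] E2(3) by blast
    thus ?thesis using sub by blast
  qed
qed

lemma quartic_radical:
  fixes x :: "'a::field_char_0 kbar"
  assumes E: "radical_extension E" and abc: "a \<in> E" "b \<in> E" "c \<in> E" "e \<in> E"
    and x: "x ^ 4 + a * x ^ 3 + b * x ^ 2 + c * x + e = 0"
  shows "\<exists>E'. radical_extension E' \<and> E \<subseteq> E' \<and> x \<in> E'"
proof -
  define A where "A = a / 4"
  define p q r where "p = b - 6 * A ^ 2" and "q = c - 2 * A * b + 8 * A ^ 3"
    and "r = e - A * c + A ^ 2 * b - 3 * A ^ 4"
  have a: "a = 4 * A" using kbar_numeral_neq_0[where 'a='a] by (simp add: A_def)
  have mem: "A \<in> E" "p \<in> E" "q \<in> E" "r \<in> E"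
    unfolding p_def q_def r_def A_def using abc by (auto intro!: radical_mem[OF E])
  have "(x + A) ^ 4 + p * (x + A) ^ 2 + q * (x + A) + r = x ^ 4 + a * x ^ 3 + b * x ^ 2 + c * x + e"
    unfolding p_def q_def r_def a by (rule quartic_completion)
  then obtain E' where E': "radical_extension E'" "E \<subseteq> E'" "x + A \<in> E'"
    using depressed_quartic_radical[OF E mem(2-4), of "x + A"] x by auto
  have "(x + A) - A \<in> E'" using radical_mem(7)[OF E'(1) E'(3)] mem(1) E'(2) by (meson subsetD)
  thus ?thesis using E' by auto
qed

lemma degree_4_radical:
  fixes x :: "'a::field_char_0 kbar"
  assumes E: "radical_extension E" and p: "\<And>k. coeff p k \<in> E" "p \<noteq> 0" "degree p \<le> 4" and x: "poly p x = 0"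
  shows "\<exists>E'. radical_extension E' \<and> E \<subseteq> E' \<and> x \<in> E'"
proof -
  define q where "q = smult (inverse (lead_coeff p)) p"
  have q: "coeff q k \<in> E" for k unfolding q_def using p(1) by (auto intro!: radical_mem[OF E])
  have dq: "degree q = degree p" using p(2) by (simp add: q_def)
  have lq: "coeff q (degree p) = 1" using p(2) by (simp add: q_def)
  have "poly q x = 0" using x by (simp add: q_def)
  hence s: "(\<Sum>k\<le>degree p. coeff q k * x ^ k) = 0" by (simp add: poly_altdef dq)
  have "degree p \<noteq> 0"
  proof
    assume "degree p = 0"
    thus False using s lq by simp
  qed
  then consider "degree p = 1" | "degree p = 2" | "degree p = 3" | "degree p = 4"
    using p(3) by linarith
  thus ?thesis
  proof cases
    case 1
    hence "x = - coeff q 0" using s lq by (simp add: eq_neg_iff_add_eq_0 add.commute)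
    thus ?thesis using E q radical_mem(3)[OF E] by blast
  next
    case 2
    hence "x ^ 2 + coeff q 1 * x + coeff q 0 = 0" using s lq by (simp add: numeral_eq_Suc algebra_simps)
    thus ?thesis using quadratic_radical[OF E q q] by blast
  next
    case 3
    hence "x ^ 3 + coeff q 2 * x ^ 2 + coeff q 1 * x + coeff q 0 = 0"
      using s lq by (simp add: numeral_eq_Suc algebra_simps)
    thus ?thesis using cubic_radical[OF E q q q] by blast
  next
    case 4
    hence "x ^ 4 + coeff q 3 * x ^ 3 + coeff q 2 * x ^ 2 + coeff q 1 * x + coeff q 0 = 0"
      using s lq by (simp add: numeral_eq_Suc algebra_simps)
    thus ?thesis using quartic_radical[OF E q q q q] by blast
  qed
qed

section \<open>Places of the closure of F(t)\<close>

abbreviation emb :: "'a::field poly \<Rightarrow> 'a kbar" where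
  "emb a \<equiv> to_ac (to_fract a)"

lemma emb_const: "emb [:c:] = const c" by (simp add: const_def)

lemma emb_pCons: "emb (pCons c p) = const c + tvar * emb p"
proof -
  have "pCons c p = [:c:] + [:0, 1:] * p" by simp
  thus ?thesis unfolding const_def tvar_def by (simp only: is_homD[OF is_hom_emb])
qed

lemma tvar_not_const: "tvar \<noteq> const c"
  by (simp add: tvar_def const_def)

lemma place_mem:
  assumes "place_at t0 V"
  shows "0 \<in> V" "1 \<in> V" "x \<in> V \<Longrightarrow> - x \<in> V" "x \<in> V \<Longrightarrow> y \<in> V \<Longrightarrow> x + y \<in> V"
    "x \<in> V \<Longrightarrow> y \<in> V \<Longrightarrow> x * y \<in> V" "x \<in> V \<Longrightarrow> y \<in> V \<Longrightarrow> x - y \<in> V" "const c \<in> V"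
    "x \<in> V \<or> inverse x \<in> V" "tvar \<in> V" "emb a \<in> V"
proof -
  have s: "subring V ring_of_type_algebra" using assms by (simp add: place_at_def)
  note e = subringE[OF s, unfolded ring_of_type_algebra_simps]
  show *: "0 \<in> V" "1 \<in> V" "x \<in> V \<Longrightarrow> - x \<in> V" "x \<in> V \<Longrightarrow> y \<in> V \<Longrightarrow> x + y \<in> V"
    "x \<in> V \<Longrightarrow> y \<in> V \<Longrightarrow> x * y \<in> V" for x y by (fact e(2,3,5,7,6))+
  show "x \<in> V \<Longrightarrow> y \<in> V \<Longrightarrow> x - y \<in> V" using *(4)[OF _ *(3)] by simp
  show c: "const c \<in> V" for c using assms by (auto simp: place_at_def)
  show "x \<in> V \<or> inverse x \<in> V" using assms by (simp add: place_at_def)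
  have "tvar - const t0 \<in> V" using assms by (simp add: place_at_def max_ideal_def)
  from *(4)[OF this c[of t0]] show t: "tvar \<in> V" by simp
  show "emb a \<in> V"
    by (induction a) (simp_all add: emb_pCons * c t)
qed

text \<open>
  The place takes the value \<open>c\<close> at \<open>x\<close>. Calculations with values are congruences modulo the
  maximal ideal; uniqueness turns them into statements on the residue.
\<close>

definition has_value :: "'a::field kbar set \<Rightarrow> 'a kbar \<Rightarrow> 'a \<Rightarrow> bool" where
  "has_value V x c \<longleftrightarrow> x - const c \<in> max_ideal V"

context
  fixes V :: "'a::{alg_closed_field,field_char_0} kbar set" and t0 :: 'a
  assumes place: "place_at t0 V"
begin

lemma max_ideal_0: "0 \<in> max_ideal V"
  using place_mem(1)[OF place] by (simp add: max_ideal_def)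

lemma max_ideal_sub: "x \<in> max_ideal V \<Longrightarrow> x \<in> V"
  by (simp add: max_ideal_def)

lemma max_ideal_mult:
  assumes "v \<in> V" "x \<in> max_ideal V"
  shows "v * x \<in> max_ideal V"
proof -
  have x: "x \<in> V" "x = 0 \<or> inverse x \<notin> V" using assms(2) by (auto simp: max_ideal_def)
  have "inverse (v * x) \<notin> V" if "v * x \<noteq> 0"
  proof
    assume "inverse (v * x) \<in> V"
    hence "v * inverse (v * x) \<in> V" using assms(1) place_mem(5)[OF place] by blast
    moreover have "v * inverse (v * x) = inverse x" using that by (simp add: field_simps)
    ultimately have "inverse x \<in> V" by metis
    thus False using x(2) that by auto
  qed
  thus ?thesis using place_mem(5)[OF place assms(1) x(1)] by (auto simp: max_ideal_def)
qed

text \<open>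
  Of \<open>x / y\<close> and \<open>y / x\<close> one lies in the valuation ring.
\<close>

lemma max_ideal_add:
  assumes "x \<in> max_ideal V" "y \<in> max_ideal V"
  shows "x + y \<in> max_ideal V"
proof -
  have *: "u + w \<in> max_ideal V" if "u \<in> max_ideal V" "w \<in> max_ideal V" "u / w \<in> V" "w \<noteq> 0" for u w
  proof -
    have "(u / w + 1) * w \<in> max_ideal V"
      using that place_mem(4)[OF place that(3) place_mem(2)[OF place]] max_ideal_mult by blast
    moreover have "(u / w + 1) * w = u + w" using that(4) by (simp add: field_simps)
    ultimately show ?thesis by simp
  qed
  show ?thesis
  proof (cases "x = 0 \<or> y = 0")
    case True
    thus ?thesis using assms by auto
  next
    case False
    have "x / y \<in> V \<or> y / x \<in> V"
      using place_mem(8)[OF place, of "x / y"] by (simp add: field_simps)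
    thus ?thesis using *[of x y] *[of y x] assms False by (auto simp: add.commute)
  qed
qed

lemma max_ideal_prime:
  assumes "x \<in> V" "y \<in> V" "x * y \<in> max_ideal V"
  shows "x \<in> max_ideal V \<or> y \<in> max_ideal V"
proof (rule ccontr)
  assume "\<not> ?thesis"
  hence n: "x \<noteq> 0" "y \<noteq> 0" "inverse x \<in> V" "inverse y \<in> V" using assms by (auto simp: max_ideal_def)
  hence "inverse (x * y) \<in> V" using place_mem(5)[OF place] by (simp add: inverse_mult_distrib)
  thus False using assms(3) n by (auto simp: max_ideal_def)
qed

lemma const_mem_max_ideal: "const c \<in> max_ideal V \<longleftrightarrow> c = 0"
proof
  assume a: "const c \<in> max_ideal V"
  show "c = 0"
  proof (rule ccontr)
    assume "c \<noteq> 0"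
    have "const c * const (inverse c) = 1"
      using \<open>c \<noteq> 0\<close> by (simp flip: is_homD(4)[OF is_hom_const] add: is_homD(2)[OF is_hom_const])
    hence "inverse (const c) = const (inverse c)" by (rule inverse_unique)
    thus False using a \<open>c \<noteq> 0\<close> place_mem(7)[OF place] by (auto simp: max_ideal_def)
  qed
qed (use max_ideal_0 in \<open>simp add: is_homD[OF is_hom_const]\<close>)

lemma has_value_mem: "has_value V x c \<Longrightarrow> x \<in> V"
  using place_mem(4)[OF place max_ideal_sub place_mem(7)[OF place], of "x - const c" c]
  by (simp add: has_value_def)

lemma has_value_const: "has_value V (const c) c"
  by (simp add: has_value_def max_ideal_0)

lemma has_value_add: "has_value V x c \<Longrightarrow> has_value V y d \<Longrightarrow> has_value V (x + y) (c + d)"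
  using max_ideal_add[of "x - const c" "y - const d"]
  by (simp add: has_value_def is_homD[OF is_hom_const] algebra_simps)

lemma has_value_mult:
  assumes "has_value V x c" "has_value V y d"
  shows "has_value V (x * y) (c * d)"
proof -
  have "x * (y - const d) + const d * (x - const c) \<in> max_ideal V"
    using assms has_value_mem[OF assms(1)] place_mem(7)[OF place]
    by (intro max_ideal_add max_ideal_mult) (auto simp: has_value_def)
  thus ?thesis by (simp add: has_value_def is_homD[OF is_hom_const] algebra_simps)
qed

lemma has_value_unique:
  assumes "has_value V x c" "has_value V x d"
  shows "c = d"
proof -
  have "(x - const c) + (- 1) * (x - const d) \<in> max_ideal V"
    using assms place_mem(2,3)[OF place] by (intro max_ideal_add max_ideal_mult) (auto simp: has_value_def)
  hence "const (d - c) \<in> max_ideal V" by (simp add: is_hom_diff[OF is_hom_const])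
  thus ?thesis by (simp add: const_mem_max_ideal)
qed

lemma place_value_eqI: "has_value V x c \<Longrightarrow> place_value V x = c"
  unfolding place_value_def by (rule the_equality) (auto simp: has_value_def dest: has_value_unique[unfolded has_value_def])

lemma has_value_peval:
  assumes "is_hom h" "is_hom k" "\<And>a. has_value V (h a) (k a)" "has_value V w c"
  shows "has_value V (peval h w p) (peval k c p)"
proof (induction p)
  case 0
  show ?case using has_value_const[of 0] by (simp add: is_homD[OF is_hom_const])
next
  case (pCons a p)
  thus ?case
    by (simp add: peval_pCons is_homD[OF assms(1)] is_homD[OF assms(2)] has_value_add has_value_mult assms)
qed

lemma has_value_ev3:
  assumes "\<And>i. has_value V (v $ i) (w $ i)"
  shows "has_value V (ev3 const v D) (ev3 (\<lambda>c. c) w D)"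
  unfolding ev3_def
  by (intro has_value_peval is_hom_peval is_hom_const is_hom_id has_value_const assms)

lemma has_value_tvar: "has_value V tvar t0"
  using place by (simp add: has_value_def place_at_def)

lemma has_value_emb: "has_value V (emb a) (poly a t0)"
proof (induction a)
  case 0
  show ?case using has_value_const[of 0] by (simp add: is_homD[OF is_hom_const])
next
  case (pCons c p)
  thus ?case unfolding emb_pCons
    by (simp add: has_value_add has_value_const has_value_mult has_value_tvar)
qed

text \<open>
  Over an algebraically closed field \<open>q\<close> is a product of linear factors, and the maximal ideal is prime.
\<close>

lemma root_of_reduction:
  assumes "q \<noteq> 0" "x \<in> V" "peval const x q \<in> max_ideal V"
  shows "\<exists>c. poly q c = 0 \<and> has_value V x c"
  using assms
proof (induction "degree q" arbitrary: q)
  case 0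
  then obtain c where "q = [:c:]" "c \<noteq> 0" by (metis degree_eq_zeroE pCons_eq_0_iff)
  thus ?case using 0(4) by (simp add: peval_pCons is_homD[OF is_hom_const] const_mem_max_ideal)
next
  case (Suc n)
  then obtain c where c: "poly q c = 0" using alg_closed_imp_poly_has_root[of q] by auto
  then obtain q' where q': "q = [:- c, 1:] * q'" by (metis poly_eq_0_iff_dvd dvdE)
  have "q' \<noteq> 0" using q' Suc.prems(1) by auto
  have "peval const x q = (x - const c) * peval const x q'"
    unfolding q' is_homD(4)[OF is_hom_peval[OF is_hom_const]]
    by (simp add: peval_pCons is_homD[OF is_hom_const] is_hom_uminus[OF is_hom_const])
  moreover have "peval const x q' \<in> V"
    by (induction q') (simp_all add: peval_pCons is_homD[OF is_hom_const] place_mem[OF place] Suc.prems)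
  ultimately have "has_value V x c \<or> peval const x q' \<in> max_ideal V"
    using max_ideal_prime Suc.prems(2,3) place_mem(6,7)[OF place] unfolding has_value_def by metis
  thus ?case
  proof
    assume "peval const x q' \<in> max_ideal V"
    moreover have "n = degree q'" using Suc(2) \<open>q' \<noteq> 0\<close> unfolding q' by (subst (asm) degree_mult_eq) auto
    ultimately obtain d where "poly q' d = 0" "has_value V x d"
      using Suc.hyps(1) \<open>q' \<noteq> 0\<close> Suc.prems(2) by blast
    thus ?thesis unfolding q' by (intro exI[of _ d]) simp
  qed (use c in blast)
qed

end

lemma clear_denominators:
  fixes p :: "'a::idom fract poly"
  shows "\<exists>a q. a \<noteq> 0 \<and> smult (to_fract a) p = map_poly to_fract q"
proof (induction p)
  case 0
  show ?case by (rule exI[of _ 1], rule exI[of _ 0]) simp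
next
  case (pCons c p)
  then obtain a q where aq: "a \<noteq> 0" "smult (to_fract a) p = map_poly to_fract q" by blast
  obtain n d where c: "c = Fraction_Field.Fract n d" "d \<noteq> 0" by (cases c) auto
  have c': "to_fract d * c = to_fract n"
    using c(2) unfolding c(1) by (simp add: Fract_conv_to_fract)
  have "smult (to_fract (a * d)) (pCons c p) = pCons (to_fract (a * n)) (smult (to_fract d) (smult (to_fract a) p))"
    by (simp add: mult_ac flip: c')
  also have "\<dots> = map_poly to_fract (pCons (a * n) (smult d q))"
    unfolding aq(2) by (simp add: map_poly_pCons map_poly_smult)
  finally show ?case using aq(1) c(2) by (intro exI[of _ "a * d"] exI) auto
qed

lemma kbar_algebraic:
  fixes x :: "'a::field kbar"
  shows "\<exists>q. q \<noteq> 0 \<and> peval emb x q = 0"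
proof -
  obtain p where p: "p \<noteq> 0" "poly (map_poly to_ac p) x = 0" by (rule alg_closure_algebraic)
  obtain a q where aq: "a \<noteq> 0" "smult (to_fract a) p = map_poly to_fract q"
    using clear_denominators by blast
  have "peval emb x q = peval to_ac x (map_poly to_fract q)" by (simp add: peval_map_poly)
  also have "\<dots> = 0" unfolding aq(2)[symmetric] peval_smult[OF is_hom_to_ac] using p(2) by (simp add: peval_def)
  finally have "peval emb x q = 0" .
  moreover have "q \<noteq> 0" using aq p(1) by auto
  ultimately show ?thesis by blast
qed

text \<open>
  As long as all coefficients vanish at \<open>t0\<close>, divide the relation by \<open>t - t0\<close>; the degree of its leading
  coefficient drops.
\<close>

lemma primitive_relation:
  fixes q :: "'a::field poly poly"
  assumes "q \<noteq> 0" "peval emb x q = 0"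
  shows "\<exists>q. map_poly (\<lambda>a. poly a t0) q \<noteq> 0 \<and> peval emb x q = 0"
  using assms
proof (induction "degree (lead_coeff q)" arbitrary: q rule: less_induct)
  case less
  show ?case
  proof (cases "map_poly (\<lambda>a. poly a t0) q = 0")
    case True
    have "poly (coeff q k) t0 = 0" for k
      using arg_cong[OF True, of "\<lambda>p. coeff p k"] by (simp add: coeff_map_poly)
    hence "[:[:- t0, 1:]:] dvd q" by (simp add: const_poly_dvd_iff poly_eq_0_iff_dvd)
    then obtain q' where q': "q = smult [:- t0, 1:] q'" by (auto elim!: dvdE)
    have nz: "q' \<noteq> 0" using q' less.prems(1) by auto
    have "lead_coeff q = [:- t0, 1:] * lead_coeff q'" unfolding q' by (simp only: lead_coeff_smult)
    hence "degree (lead_coeff q) = 1 + degree (lead_coeff q')" using nz by (simp only: degree_mult_eq) 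
        (subst degree_mult_eq, auto)
    moreover have "emb [:- t0, 1:] * peval emb x q' = 0"
      using less.prems(2) unfolding q' peval_smult[OF is_hom_emb] .
    hence "peval emb x q' = 0" by (simp only: mult_eq_0_iff) simp
    ultimately show ?thesis using less.hyps[of q'] nz by auto
  qed (use less.prems in blast)
qed

text \<open>
  The residue field of the place is \<open>F\<close>: an algebraic relation for \<open>x\<close> over \<open>F[t]\<close>, not divisible by
  \<open>t - t0\<close>, reduces to a nonzero polynomial over \<open>F\<close> that the residue of \<open>x\<close> satisfies.
\<close>

lemma place_residue:
  fixes V :: "'a::{alg_closed_field,field_char_0} kbar set"
  assumes place: "place_at t0 V" and x: "x \<in> V"
  shows "\<exists>c. has_value V x c"
proof -
  obtain q where q: "map_poly (\<lambda>a. poly a t0) q \<noteq> 0" "peval emb x q = 0"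
    using kbar_algebraic[of x] primitive_relation by blast
  let ?q0 = "map_poly (\<lambda>a. poly a t0) q"
  have cong: "peval emb x p - peval (\<lambda>a. const (poly a t0)) x p \<in> max_ideal V" for p
  proof (induction p)
    case (pCons a p)
    have "(emb a - const (poly a t0)) + x * (peval emb x p - peval (\<lambda>a. const (poly a t0)) x p) \<in> max_ideal V"
      using has_value_emb[OF place, of a, unfolded has_value_def] pCons x
      by (intro max_ideal_add[OF place] max_ideal_mult[OF place])
    thus ?case by (simp add: peval_pCons algebra_simps is_homD[OF is_hom_const])
  qed (simp add: max_ideal_0[OF place])
  have "- 1 * (0 - peval (\<lambda>a. const (poly a t0)) x q) \<in> max_ideal V"
    using cong[of q] place_mem(2,3)[OF place] unfolding q(2) by (intro max_ideal_mult[OF place]) auto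
  hence "peval const x ?q0 \<in> max_ideal V"
    by (simp add: peval_map_poly is_homD[OF is_hom_const])
  thus ?thesis using root_of_reduction[OF place q(1) x] by blast
qed

lemma place_poly_mem:
  assumes "place_at t0 V" "\<And>k. coeff p k \<in> V" "x \<in> V"
  shows "poly p x \<in> V"
  using assms(2)
proof (induction p)
  case (pCons a p)
  have "a \<in> V" "coeff p k \<in> V" for k
    using pCons.prems[of 0] pCons.prems[of "Suc k"] by auto
  thus ?case using pCons.IH place_mem(4,5)[OF assms(1)] assms(3) by simp
qed (simp add: place_mem(1)[OF assms(1)])

text \<open>
  Valuation rings are integrally closed. If \<open>x\<close> were not in \<open>V\<close>, then \<open>1 / x\<close> would be in the maximal ideal, and
  dividing the equation of \<open>x\<close> by a power of \<open>x\<close> would put the leading coefficient there, too.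
\<close>

lemma root_mem_place:
  fixes V :: "'a::{alg_closed_field,field_char_0} kbar set"
  assumes place: "place_at t0 V" and h: "\<And>k. coeff h k \<in> V" "lead_coeff h \<notin> max_ideal V"
    and x: "poly h x = 0"
  shows "x \<in> V"
proof (rule ccontr)
  assume n: "x \<notin> V"
  define y where "y = inverse x"
  have yV: "y \<in> V" using n place_mem(8)[OF place, of x] by (simp add: y_def)
  have x0: "x \<noteq> 0" using n place_mem(1)[OF place] by auto
  have ym: "y \<in> max_ideal V" using yV n by (simp add: max_ideal_def y_def)
  \<comment> \<open>The constant coefficient of the reflected polynomial is the leading coefficient of \<open>h\<close>.\<close>
  have "poly (reflect_poly h) y = 0"
    using x x0 by (subst poly_reflect_poly_nz) (simp_all add: y_def)
  moreover obtain c q where cq: "reflect_poly h = pCons c q" by (rule pCons_cases)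
  moreover have c: "c = lead_coeff h"
    using arg_cong[OF cq, of "\<lambda>p. coeff p 0"] by simp
  ultimately have eq: "lead_coeff h = (- poly q y) * y" by (simp add: eq_neg_iff_add_eq_0 mult.commute)
  have "coeff q k \<in> V" for k
    using arg_cong[OF cq, of "\<lambda>p. coeff p (Suc k)"] h(1)[of "degree h - Suc k"] place_mem(1)[OF place]
    by (auto simp: coeff_reflect_poly split: if_splits)
  hence "- poly q y \<in> V" using place_poly_mem[OF place _ yV] place_mem(3)[OF place] by blast
  hence "lead_coeff h \<in> max_ideal V" unfolding eq using ym by (rule max_ideal_mult[OF place])
  thus False using h(2) by contradiction
qed

lemma prod_mset_mem_place:
  assumes place: "place_at t0 V"
  shows "(\<And>x. x \<in># A \<Longrightarrow> f x \<in> V) \<Longrightarrow> (\<Prod>x\<in>#A. f x) \<in> V"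
  by (induction A) (simp_all add: place_mem[OF place])

lemma prod_mem_max_ideal:
  fixes V :: "'a::{alg_closed_field,field_char_0} kbar set"
  assumes place: "place_at t0 V"
  shows "(\<And>x. x \<in># A \<Longrightarrow> f x \<in> V) \<Longrightarrow> (\<Prod>x\<in>#A. f x) \<in> max_ideal V \<Longrightarrow> \<exists>x. x \<in># A \<and> f x \<in> max_ideal V"
proof (induction A)
  case empty
  have "const 1 \<in> max_ideal V" using empty(2) by (simp add: is_homD[OF is_hom_const])
  thus ?case using const_mem_max_ideal[OF place, of 1] by simp
next
  case (add x A)
  have fA: "f x \<in> V" "\<And>y. y \<in># A \<Longrightarrow> f y \<in> V" using add.prems(1) by auto
  have "(\<Prod>y\<in>#A. f y) \<in> V" using prod_mset_mem_place[OF place] fA(2) by blast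
  hence "f x \<in> max_ideal V \<or> (\<Prod>y\<in>#A. f y) \<in> max_ideal V"
    using add.prems(2) fA(1) by (intro max_ideal_prime[OF place]) simp_all
  thus ?case using add.IH fA(2) by auto
qed

text \<open>
  Over the closure \<open>H\<close> is its leading coefficient times \<open>\<Prod>(s - s\<^sub>i)\<close>, with all \<open>s\<^sub>i\<close> in \<open>V\<close>. At \<open>s = s0\<close> the
  value is in the maximal ideal and the leading coefficient is not, so some \<open>s0 - s\<^sub>i\<close> is.
\<close>

lemma lift_root:
  fixes V :: "'a::{alg_closed_field,field_char_0} kbar set"
  assumes place: "place_at t0 V" and lc: "poly (lead_coeff H) t0 \<noteq> 0"
    and root: "peval (\<lambda>a. poly a t0) s0 H = 0"
  shows "\<exists>s. peval emb s H = 0 \<and> has_value V s s0"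
proof -
  define h where "h = map_poly emb H"
  have coeff_h: "coeff h k = emb (coeff H k)" for k by (simp add: h_def coeff_map_poly)
  have deg: "degree h = degree H" unfolding h_def by (rule degree_map_poly) simp
  have lc_h: "lead_coeff h = emb (lead_coeff H)" unfolding deg coeff_h ..
  have lc_m: "lead_coeff h \<notin> max_ideal V"
  proof
    assume "lead_coeff h \<in> max_ideal V"
    hence "has_value V (emb (lead_coeff H)) 0" by (simp add: has_value_def lc_h is_homD[OF is_hom_const])
    thus False using has_value_unique[OF place _ has_value_emb[OF place]] lc by metis
  qed
  have lc_V: "lead_coeff h \<in> V" unfolding lc_h by (rule place_mem(10)[OF place])
  have "h \<noteq> 0" using lc_m max_ideal_0[OF place] by auto
  then obtain A where A: "h = smult (lead_coeff h) (\<Prod>x\<in>#A. [:- x, 1:])"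
    using alg_closed_imp_factorization by blast
  have ph: "poly h y = lead_coeff h * (\<Prod>x\<in>#A. y - x)" for y
    by (subst A) (simp add: poly_prod_mset image_mset.compositionality o_def)
  have AV: "x \<in> V" "poly h x = 0" if "x \<in># A" for x
  proof -
    show "poly h x = 0" unfolding ph using that by (auto simp: prod_mset_zero_iff)
    thus "x \<in> V"
      by (rule root_mem_place[OF place _ lc_m, rotated]) (simp add: coeff_h place_mem[OF place])
  qed
  have V0: "const s0 \<in> V" by (rule place_mem(7)[OF place])
  have "has_value V (peval emb (const s0) H) (peval (\<lambda>a. poly a t0) s0 H)"
    by (intro has_value_peval[OF place] is_hom_emb is_hom_poly has_value_emb[OF place] has_value_const[OF place])
  hence "poly h (const s0) \<in> max_ideal V"
    unfolding root by (simp add: has_value_def peval_def h_def is_homD[OF is_hom_const])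
  hence "(\<Prod>x\<in>#A. const s0 - x) \<in> max_ideal V"
    using max_ideal_prime[OF place lc_V prod_mset_mem_place[OF place]] lc_m
      place_mem(6)[OF place V0 AV(1)] unfolding ph by blast
  then obtain x where x: "x \<in># A" "const s0 - x \<in> max_ideal V"
    using prod_mem_max_ideal[OF place, of A "\<lambda>x. const s0 - x"] AV(1) V0 place_mem(6)[OF place] by blast
  have "(- 1) * (const s0 - x) \<in> max_ideal V"
    using x(2) place_mem(2,3)[OF place] by (intro max_ideal_mult[OF place]) auto
  hence "has_value V x s0" by (simp add: has_value_def)
  thus ?thesis using AV(2)[OF x(1)] by (auto simp: h_def peval_def)
qed

section \<open>Coordinates adapted to a pencil\<close>

text \<open>
  The bases \<open>e, a, b\<close> of linear forms and \<open>p, u, w\<close> of vectors are dual. In the intended use \<open>a\<close> and \<open>b\<close> span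
  the pencil and \<open>p\<close> is its base point. The first conjunct is the resolution of the identity as a
  system of scalar equations, which carries over to the closure of \<open>F(t)\<close>.
\<close>

definition dual_bases :: "'b::comm_ring_1 ^ 3 \<Rightarrow> 'b ^ 3 \<Rightarrow> 'b ^ 3 \<Rightarrow> 'b ^ 3 \<Rightarrow> 'b ^ 3 \<Rightarrow> 'b ^ 3 \<Rightarrow> bool" where
  "dual_bases e a b p u w \<longleftrightarrow>
     (\<forall>i j. e $ j * p $ i + a $ j * u $ i + b $ j * w $ i = (if i = j then 1 else 0)) \<and>
     linear_form a p = 0 \<and> linear_form a u = 1 \<and> linear_form a w = 0 \<and>
     linear_form b p = 0 \<and> linear_form b u = 0 \<and> linear_form b w = 1"

lemma dual_bases_expand:
  assumes "dual_bases e a b p u w"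
  shows "v = linear_form e v *s p + linear_form a v *s u + linear_form b v *s w"
proof -
  have "(linear_form e v *s p + linear_form a v *s u + linear_form b v *s w) $ i = v $ i" for i
  proof -
    have "(linear_form e v *s p + linear_form a v *s u + linear_form b v *s w) $ i =
      (\<Sum>j\<in>UNIV. v $ j * (e $ j * p $ i + a $ j * u $ i + b $ j * w $ i))"
      by (simp add: linear_form_def sum_3 algebra_simps)
    also have "\<dots> = (\<Sum>j\<in>UNIV. v $ j * (if i = j then 1 else 0))"
      using assms by (simp add: dual_bases_def)
    also have "\<dots> = v $ i" using exhaust_3[of i] by (auto simp: sum_3)
    finally show ?thesis .
  qed
  thus ?thesis by (simp add: vec_eq_iff)
qed

lemma linear_form_linear:
  "linear_form l (v + w) = linear_form l v + linear_form l w"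
  "linear_form l (c *s v) = c * linear_form l v"
  "linear_form (l + m) v = linear_form l v + linear_form m v"
  "linear_form (c *s l) v = c * linear_form l v"
  by (simp_all add: linear_form_def sum.distrib sum_distrib_left algebra_simps)

lemma linear_form_diff:
  fixes l :: "'b::comm_ring_1 ^ 'n"
  shows "linear_form l (v - w) = linear_form l v - linear_form l w"
  by (simp add: linear_form_def sum_subtractf algebra_simps)

lemma linear_form_0: "linear_form l 0 = (0 :: 'b::comm_ring_1)"
  by (simp add: linear_form_def)

lemma const_vec_linear_form: "linear_form (const_vec l) (const_vec v) = const (linear_form l v)"
  by (simp add: linear_form_def const_vec_def is_hom_sum[OF is_hom_const] is_homD[OF is_hom_const])

lemma dual_bases_const_vec:
  assumes "dual_bases e a b p u w"
  shows "dual_bases (const_vec e) (const_vec a) (const_vec b) (const_vec p) (const_vec u) (const_vec w)"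
proof -
  have "const (e $ j * p $ i + a $ j * u $ i + b $ j * w $ i) = const (if i = j then 1 else 0)" for i j
    using assms by (simp add: dual_bases_def)
  hence "const (e $ j) * const (p $ i) + const (a $ j) * const (u $ i) + const (b $ j) * const (w $ i) = (if i = j then 1 else 0)" for i j
    by (simp add: is_homD[OF is_hom_const] split: if_splits)
  moreover have "const (e $ j) = const_vec e $ j" for e :: "'a ^ 3" and j by (simp add: const_vec_def)
  ultimately show ?thesis
    using assms unfolding dual_bases_def const_vec_linear_form by (simp add: is_homD[OF is_hom_const])
qed

text \<open>
  The base point is a multiple of the cross product \<open>c\<close> of the two linear forms. If \<open>c\<^sub>k \<noteq> 0\<close>, the \<open>k\<close>-th
  coordinate completes the two forms to a basis, and the dual vectors are cross products again.
\<close>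

lemma pencil_dual_bases:
  fixes P :: "('a::field ^ 3) set"
  assumes "is_pencil P a b" "P \<in> proj_space"
  shows "\<exists>e p u w. p \<noteq> 0 \<and> P = proj_point p \<and> dual_bases e a b p u w"
proof -
  obtain p where p: "P = proj_point p" "p \<noteq> 0" using assms(2) by (auto simp: proj_space_def)
  have pP: "p \<in> P" unfolding p(1) proj_point_def using vector_smult_lid[of p] by (metis (mono_tags, lifting) mem_Collect_eq one_neq_zero)
  define a1 a2 a3 where "a1 = a $ 1" and "a2 = a $ 2" and "a3 = a $ 3"
  define b1 b2 b3 where "b1 = b $ 1" and "b2 = b $ 2" and "b3 = b $ 3"
  define p1 p2 p3 where "p1 = p $ 1" and "p2 = p $ 2" and "p3 = p $ 3"
  note defs = a1_def a2_def a3_def b1_def b2_def b3_def p1_def p2_def p3_def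
  \<comment> \<open>The cross product of \<open>a\<close> and \<open>b\<close>.\<close>
  define c1 c2 c3 where "c1 = a2 * b3 - a3 * b2" and "c2 = a3 * b1 - a1 * b3" and "c3 = a1 * b2 - a2 * b1"
  have ap: "a1 * p1 + a2 * p2 + a3 * p3 = 0" and bp: "b1 * p1 + b2 * p2 + b3 * p3 = 0"
    using assms(1) pP by (auto simp: is_pencil_def linear_form_def sum_3 defs)
  have lf: "linear_form a v = a1 * v $ 1 + a2 * v $ 2 + a3 * v $ 3"
    "linear_form b v = b1 * v $ 1 + b2 * v $ 2 + b3 * v $ 3" for v
    by (simp_all add: linear_form_def sum_3 defs)
  have indep: "x = 0 \<and> y = 0" if "x *s a + y *s b = 0" for x y
    using assms(1) that by (auto simp: is_pencil_def)
  have cross: "c1 \<noteq> 0 \<or> c2 \<noteq> 0 \<or> c3 \<noteq> 0"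
  proof (rule ccontr)
    assume "\<not> ?thesis"
    hence c: "a2 * b3 = a3 * b2" "a3 * b1 = a1 * b3" "a1 * b2 = a2 * b1"
      by (auto simp: c1_def c2_def c3_def)
    have "b1 *s a + (- a1) *s b = 0" "b2 *s a + (- a2) *s b = 0" "b3 *s a + (- a3) *s b = 0"
      using c by (auto simp: vec_eq_iff forall_3 defs mult.commute)
    hence "b1 = 0" "b2 = 0" "b3 = 0" using indep by blast+
    hence "0 *s a + 1 *s b = 0" by (simp add: vec_eq_iff forall_3 defs)
    from indep[OF this] show False by simp
  qed
  have ratio: "c1 * p2 = c2 * p1" "c2 * p3 = c3 * p2" "c3 * p1 = c1 * p3"
  proof -
    have "c1 * p2 - c2 * p1 = b3 * (a1 * p1 + a2 * p2 + a3 * p3) - a3 * (b1 * p1 + b2 * p2 + b3 * p3)"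
      by (simp add: c1_def c2_def algebra_simps)
    thus "c1 * p2 = c2 * p1" unfolding ap bp by simp
    have "c2 * p3 - c3 * p2 = b1 * (a1 * p1 + a2 * p2 + a3 * p3) - a1 * (b1 * p1 + b2 * p2 + b3 * p3)"
      by (simp add: c2_def c3_def algebra_simps)
    thus "c2 * p3 = c3 * p2" unfolding ap bp by simp
    have "c3 * p1 - c1 * p3 = b2 * (a1 * p1 + a2 * p2 + a3 * p3) - a2 * (b1 * p1 + b2 * p2 + b3 * p3)"
      by (simp add: c1_def c3_def algebra_simps)
    thus "c3 * p1 = c1 * p3" unfolding ap bp by simp
  qed
  have pnz: "p1 \<noteq> 0 \<or> p2 \<noteq> 0 \<or> p3 \<noteq> 0" using p(2) by (auto simp: vec_eq_iff forall_3 defs)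
  have vec: "a = vector [a1, a2, a3]" "b = vector [b1, b2, b3]" "p = vector [p1, p2, p3]"
    using vec3_eq by (simp_all add: defs)
  from cross consider "c1 \<noteq> 0" | "c2 \<noteq> 0" | "c3 \<noteq> 0" by blast
  hence "\<exists>e u w. dual_bases e a b p u w"
  proof cases
    case 1
    hence "p1 \<noteq> 0" using pnz ratio by auto
    hence q: "p2 / p1 = c2 / c1" "p3 / p1 = c3 / c1" using 1 ratio by (simp_all add: field_simps)
    show ?thesis
      by (rule exI[of _ "vector [1 / p1, 0, 0]"], rule exI[of _ "vector [0, b3 / c1, - b2 / c1]"],
          rule exI[of _ "vector [0, - a3 / c1, a2 / c1]"],
          simp add: dual_bases_def linear_form_def sum_3 vec forall_3 q ap bp 1 \<open>p1 \<noteq> 0\<close>,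
          simp add: 1 divide_simps, simp add: c1_def c2_def c3_def algebra_simps)
  next
    case 2
    hence "p2 \<noteq> 0" using pnz ratio by auto
    hence q: "p1 / p2 = c1 / c2" "p3 / p2 = c3 / c2" using 2 ratio by (simp_all add: field_simps)
    show ?thesis
      by (rule exI[of _ "vector [0, 1 / p2, 0]"], rule exI[of _ "vector [- b3 / c2, 0, b1 / c2]"],
          rule exI[of _ "vector [a3 / c2, 0, - a1 / c2]"],
          simp add: dual_bases_def linear_form_def sum_3 vec forall_3 q ap bp 2 \<open>p2 \<noteq> 0\<close>,
          simp add: 2 divide_simps, simp add: c1_def c2_def c3_def algebra_simps)
  next
    case 3
    hence "p3 \<noteq> 0" using pnz ratio by auto
    hence q: "p1 / p3 = c1 / c3" "p2 / p3 = c2 / c3" using 3 ratio by (simp_all add: field_simps)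
    show ?thesis
      by (rule exI[of _ "vector [0, 0, 1 / p3]"], rule exI[of _ "vector [b2 / c3, - b1 / c3, 0]"],
          rule exI[of _ "vector [- a2 / c3, a1 / c3, 0]"],
          simp add: dual_bases_def linear_form_def sum_3 vec forall_3 q ap bp 3 \<open>p3 \<noteq> 0\<close>,
          simp add: 3 divide_simps, simp add: c1_def c2_def c3_def algebra_simps)
  qed
  thus ?thesis using p by blast
qed

section \<open>Multiplicity\<close>

lemma self_mem_proj_point: "v \<in> proj_point v"
  unfolding proj_point_def by (rule CollectI, rule exI[of _ 1]) simp

lemma mem_proj_point: "v \<in> proj_point p \<Longrightarrow> \<exists>c. c \<noteq> 0 \<and> v = c *s p"
  unfolding proj_point_def by blast

lemma poly_ev3_line:
  "poly (ev3 (\<lambda>c. [:c:]) (\<chi> i. [:v $ i, w $ i:]) D) s = ev3 (\<lambda>c. c) (v + s *s w) D"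
proof -
  have "(\<chi> i. v $ i + s * w $ i) = v + s *s w" by (simp add: vec_eq_iff)
  thus ?thesis by (subst hom_ev3[OF is_hom_const_poly is_hom_poly]) simp
qed

text \<open>
  If every partial derivative vanished at \<open>p\<close>, then \<open>D\<close> would have a zero of infinite order at \<open>p\<close> on
  every line through \<open>p\<close>, so it would be 0.
\<close>

lemma multiplicity_attained:
  fixes D :: "'a::field_char_0 poly poly poly"
  assumes "D \<noteq> 0"
  shows "\<exists>i j k. eval3 (partial_deriv i j k D) p \<noteq> 0"
proof (rule ccontr)
  assume a: "\<not> ?thesis"
  have "ev3 (\<lambda>c. c) v D = 0" for v
  proof -
    define q where "q = ev3 (\<lambda>c. [:c:]) (\<chi> i. [:p $ i, (v - p) $ i:]) D"
    have "coeff q n = 0" for n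
      unfolding q_def by (rule order_along_line[of "\<lambda>c. c" "Suc n", OF is_hom_id]) (use a in auto)
    hence "q = 0" by (intro poly_eqI) simp
    hence "poly q 1 = 0" by simp
    thus ?thesis unfolding q_def poly_ev3_line by simp
  qed
  thus False using ev3_eq_0_imp assms by blast
qed

lemma curve_multiplicity_props:
  fixes \<Gamma> :: "('a::field_char_0 ^ 3) set set"
  defines "D \<equiv> defining_form \<Gamma>"
  assumes D: "D \<noteq> 0" "is_form d D"
  shows "i + j + k < curve_multiplicity \<Gamma> (proj_point p) \<Longrightarrow> eval3 (partial_deriv i j k D) p = 0"
    and "curve_multiplicity \<Gamma> (proj_point p) = 0 \<Longrightarrow> eval3 D p \<noteq> 0"
proof -
  let ?Q = "\<lambda>m. \<exists>i j k. i + j + k = m \<and> (\<exists>v\<in>proj_point p. eval3 (partial_deriv i j k D) v \<noteq> 0)"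
  have m: "curve_multiplicity \<Gamma> (proj_point p) = (LEAST m. ?Q m)"
    by (simp add: curve_multiplicity_def D_def)
  show "eval3 (partial_deriv i j k D) p = 0" if "i + j + k < curve_multiplicity \<Gamma> (proj_point p)"
    using not_less_Least[of "i + j + k" ?Q] that self_mem_proj_point[of p] unfolding m by blast
  show "eval3 D p \<noteq> 0" if 0: "curve_multiplicity \<Gamma> (proj_point p) = 0"
  proof -
    have "\<exists>m. ?Q m" using multiplicity_attained[OF D(1), of p] self_mem_proj_point[of p] by blast
    hence "?Q 0" using LeastI_ex[of ?Q] 0 unfolding m by simp
    then obtain v where v: "v \<in> proj_point p" "eval3 D v \<noteq> 0" by (auto simp: partial_deriv_def)
    obtain c where "v = c *s p" using mem_proj_point[OF v(1)] by blast
    thus ?thesis using v(2) ev3_form[OF D(2) is_hom_id] by (auto simp: eval3_eq_ev3)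
  qed
qed

section \<open>The moving line and the curve\<close>

text \<open>
  An irreducible form \<open>D\<close> of degree \<open>d\<close> with a \<open>(d - r)\<close>-fold point \<open>p\<close>, in coordinates adapted to a pencil
  through \<open>p\<close>. The multiplicity enters as a lower bound (\<open>mult\<close>) and, if it is 0, as the fact that \<open>p\<close> is not on
  the curve (\<open>mult0\<close>).
\<close>

locale curve_with_pencil =
  fixes D :: "'a::{alg_closed_field,field_char_0} poly poly poly" and d r :: nat
    and e a b p u w :: "'a ^ 3"
  assumes irr: "irreducible D" and form: "is_form d D"
    and r: "1 \<le> r" "r \<le> 4" "r \<le> d"
    and dual: "dual_bases e a b p u w" and p0: "p \<noteq> 0"
    and mult: "\<And>i j k. i + j + k < d - r \<Longrightarrow> eval3 (partial_deriv i j k D) p = 0"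
    and mult0: "d = r \<Longrightarrow> eval3 D p \<noteq> 0"
begin

abbreviation DF :: "'a ^ 3 \<Rightarrow> 'a" where "DF v \<equiv> ev3 (\<lambda>c. c) v D"
abbreviation DK :: "'a kbar ^ 3 \<Rightarrow> 'a kbar" where "DK v \<equiv> ev3 const v D"

lemma DF_scale: "DF (c *s v) = c ^ d * DF v"
  by (rule ev3_form[OF form is_hom_id])

lemma DK_scale: "DK (c *s v) = c ^ d * DK v"
  by (rule ev3_form[OF form is_hom_const])

lemmas dual_simps =
  dual[unfolded dual_bases_def, THEN conjunct2]

text \<open>
  Otherwise \<open>D\<close> is a multiple of \<open>l\<close>, so \<open>d = 1\<close> and \<open>r = 1\<close>; then \<open>p\<close> has multiplicity 0 and yet lies on
  the line.
\<close>

lemma not_vanishing_on_line: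
  assumes l: "l \<noteq> 0" "linear_form l p = 0"
  shows "\<exists>v. linear_form l v = 0 \<and> DF v \<noteq> 0"
proof (rule ccontr)
  assume "\<not> ?thesis"
  hence "linear_form l v = 0 \<Longrightarrow> DF v = 0" for v by blast
  from irreducible_vanishing_on_line[OF irr l(1) this] obtain c
    where c: "c \<noteq> 0" "\<And>v. DF v = c * linear_form l v" by blast
  obtain i where i: "l $ i \<noteq> 0" using l(1) by (auto simp: vec_eq_iff)
  have ax: "linear_form l (axis i 1) = l $ i"
    using exhaust_3[of i] by (auto simp: linear_form_def sum_3 axis_def)
  \<comment> \<open>Comparing degrees: \<open>D\<close> scales with exponent \<open>d\<close>, a linear form with exponent 1.\<close>
  have "2 ^ d * DF (axis i 1) = DF (2 *s axis i 1)" by (simp only: DF_scale)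
  also have "\<dots> = 2 * DF (axis i 1)" by (simp add: c(2) linear_form_linear)
  finally have "(2 :: 'a) ^ d = 2" using i c(1) by (simp add: c(2) ax)
  hence "of_nat (2 ^ d) = (of_nat 2 :: 'a)" by simp
  hence "2 ^ d = (2 :: nat)" by (simp only: of_nat_eq_iff)
  hence "d = 1" by (metis power_inject_exp power_one_right one_less_numeral_iff semiring_norm(76))
  hence "DF p \<noteq> 0" using mult0 r by (simp add: eval3_eq_ev3)
  thus False using c(2)[of p] l(2) by simp
qed

text \<open>
  The points \<open>s p + x u + y w\<close> with \<open>s \<noteq> 0\<close> are all points of a line through \<open>p\<close> except two, so if \<open>D\<close>
  vanishes at them, it vanishes on the whole line.
\<close>

lemma not_vanishing_along:
  assumes xy: "x \<noteq> 0 \<or> y \<noteq> 0"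
  shows "\<exists>s. s \<noteq> 0 \<and> DF (s *s p + (x *s u + y *s w)) \<noteq> 0"
proof (rule ccontr)
  define v0 where "v0 = x *s u + y *s w"
  assume "\<not> ?thesis"
  hence van: "DF (s *s p + v0) = 0" if "s \<noteq> 0" for s using that by (auto simp: v0_def)
  have poly: "DF (s *s p + t *s v0) = 0" for s t
  proof -
    define q where "q = ev3 (\<lambda>c. [:c:]) (\<chi> i. [:(s *s p) $ i, v0 $ i:]) D"
    define q' where "q' = ev3 (\<lambda>c. [:c:]) (\<chi> i. [:(t *s v0) $ i, p $ i:]) D"
    have q: "poly q l = DF (s *s p + l *s v0)" for l
      unfolding q_def by (rule poly_ev3_line)
    have q': "poly q' l = DF (l *s p + t *s v0)" for l
      unfolding q'_def poly_ev3_line by (simp only: add.commute)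
    have nz: "DF (l *s p + m *s v0) = 0" if "l \<noteq> 0" "m \<noteq> 0" for l m
    proof -
      have "l *s p + m *s v0 = m *s ((l / m) *s p + v0)"
        using that by (simp add: vec_eq_iff field_simps)
      thus ?thesis using van[of "l / m"] that by (simp only: DF_scale) simp
    qed
    \<comment> \<open>\<open>D\<close> vanishes for \<open>s, t \<noteq> 0\<close>; the polynomials \<open>q'\<close> and \<open>q\<close> extend this to \<open>s = 0\<close> and to \<open>t = 0\<close>.\<close>
    show ?thesis
    proof (cases "t = 0")
      case False
      have "poly (q' * [:0, 1:]) l = 0" for l using nz[of l t] False by (cases "l = 0") (auto simp: q')
      hence "q' * [:0, 1:] = 0" using poly_all_0_iff_0 by blast
      hence "q' = 0" by simp
      thus ?thesis using q'[of s] by simp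
    next
      case True
      show ?thesis
      proof (cases "s = 0")
        case False
        have "poly (q * [:0, 1:]) l = 0" for l using nz[of s l] False by (cases "l = 0") (auto simp: q)
        hence "q * [:0, 1:] = 0" using poly_all_0_iff_0 by blast
        hence "q = 0" by simp
        thus ?thesis using q[of t] by simp
      next
        case s0: True
        have "d \<noteq> 0" using r by simp
        thus ?thesis using DF_scale[of 0 p] True s0 by simp
      qed
    qed
  qed
  \<comment> \<open>The linear form of the line through \<open>p\<close> and \<open>x u + y w\<close>.\<close>
  define l where "l = y *s a + (- x) *s b"
  have lv: "linear_form l v = y * linear_form a v - x * linear_form b v" for v
    unfolding l_def linear_form_linear by simp
  have "linear_form l u = y" "linear_form l w = - x" "linear_form l p = 0"
    using dual_simps by (simp_all add: lv)
  moreover from this have "l \<noteq> 0" using xy by (auto simp: linear_form_def)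
  ultimately obtain v where v: "linear_form l v = 0" "DF v \<noteq> 0"
    using not_vanishing_on_line[of l] by blast
  define m where "m = (if x \<noteq> 0 then linear_form a v / x else linear_form b v / y)"
  have "linear_form a v = m * x" "linear_form b v = m * y"
    using v(1) xy by (auto simp: m_def lv field_simps)
  hence "v = linear_form e v *s p + m *s v0"
    using dual_bases_expand[OF dual, of v] by (simp add: v0_def vector_add_ldistrib vector_smult_assoc add.assoc)
  hence "DF v = 0" using poly by metis
  thus False using v(2) by contradiction
qed

definition line_poly :: "'a ^ 3 \<Rightarrow> 'a poly" where
  "line_poly v = ev3 (\<lambda>c. [:c:]) (\<chi> i. [:v $ i, p $ i:]) D"

lemma poly_line_poly: "poly (line_poly v) s = DF (s *s p + v)"
  unfolding line_poly_def poly_ev3_line by (simp only: add.commute)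

lemma finite_on_line:
  assumes "x \<noteq> 0 \<or> y \<noteq> 0"
  shows "finite {proj_point (s *s p + (x *s u + y *s w)) | s. DF (s *s p + (x *s u + y *s w)) = 0}"
proof -
  have "line_poly (x *s u + y *s w) \<noteq> 0"
    using not_vanishing_along[OF assms] by (auto simp flip: poly_line_poly)
  hence "finite {s. DF (s *s p + (x *s u + y *s w)) = 0}"
    unfolding poly_line_poly[symmetric] by (rule poly_roots_finite)
  hence "finite ((\<lambda>s. proj_point (s *s p + (x *s u + y *s w))) ` {s. DF (s *s p + (x *s u + y *s w)) = 0})"
    by (rule finite_imageI)
  thus ?thesis by (rule rev_finite_subset) auto
qed

text \<open>
  The points other than \<open>p\<close> of the moving line \<open>a + t b = 0\<close>. The coordinate of \<open>w\<close> is normalised to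
  \<open>- 1\<close>, which makes that of \<open>u\<close> equal to \<open>t\<close>.
\<close>

definition moving_point :: "'a kbar \<Rightarrow> 'a kbar ^ 3" where
  "moving_point s = s *s const_vec p + (tvar *s const_vec u - const_vec w)"

text \<open>
  \<open>D\<close> on the moving line, as a polynomial in \<open>s\<close> over \<open>F[t]\<close>. Its roots are the parameters of the
  intersection points. The multiplicity of \<open>p\<close> is visible in the reversed polynomial, which uses the
  parameter \<open>\<lambda> = 1 / s\<close> centred at \<open>p\<close>.
\<close>

definition restriction :: "'a poly poly" where
  "restriction = ev3 (\<lambda>c. [:[:c:]:]) (\<chi> i. [:[:- w $ i, u $ i:], [:p $ i:]:]) D"

definition reversed_restriction :: "'a poly poly" where
  "reversed_restriction = ev3 (\<lambda>c. [:[:c:]:]) (\<chi> i. [:[:p $ i:], [:- w $ i, u $ i:]:]) D"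

lemma peval_restriction: "peval emb s restriction = DK (moving_point s)"
proof -
  have "(\<lambda>x. peval emb s [:[:x:]:]) = const"
    by (rule ext) (simp add: peval_pCons emb_const)
  moreover have "(\<chi> i. peval emb s ((\<chi> i. [:[:- w $ i, u $ i:], [:p $ i:]:]) $ i)) = moving_point s"
    by (simp add: vec_eq_iff peval_pCons emb_const emb_pCons moving_point_def const_vec_def
        is_hom_uminus[OF is_hom_const] algebra_simps)
  ultimately show ?thesis
    unfolding restriction_def hom_ev3[OF is_hom_const_poly2 is_hom_peval[OF is_hom_emb]] by simp
qed

lemma peval_reversed_restriction:
  "peval emb l reversed_restriction = DK (const_vec p + l *s (tvar *s const_vec u - const_vec w))"
proof -
  have "(\<lambda>x. peval emb l [:[:x:]:]) = const"
    by (rule ext) (simp add: peval_pCons emb_const)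
  moreover have "(\<chi> i. peval emb l ((\<chi> i. [:[:p $ i:], [:- w $ i, u $ i:]:]) $ i)) =
      const_vec p + l *s (tvar *s const_vec u - const_vec w)"
    by (simp add: vec_eq_iff peval_pCons emb_const emb_pCons const_vec_def
        is_hom_uminus[OF is_hom_const] algebra_simps)
  ultimately show ?thesis
    unfolding reversed_restriction_def hom_ev3[OF is_hom_const_poly2 is_hom_peval[OF is_hom_emb]] by simp
qed

lemma restriction_at:
  "peval (\<lambda>c. poly c t0) s restriction = DF (s *s p + (t0 *s u + (-1) *s w))"
proof -
  have "(\<lambda>x. peval (\<lambda>c. poly c t0) s [:[:x:]:]) = (\<lambda>x. x)"
    by (rule ext) (simp add: peval_pCons)
  moreover have "(\<chi> i. peval (\<lambda>c. poly c t0) s ((\<chi> i. [:[:- w $ i, u $ i:], [:p $ i:]:]) $ i)) =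
      s *s p + (t0 *s u + (-1) *s w)"
    by (simp add: vec_eq_iff peval_pCons algebra_simps)
  ultimately show ?thesis
    unfolding restriction_def hom_ev3[OF is_hom_const_poly2 is_hom_peval[OF is_hom_poly]] by simp
qed

lemma reversed_restriction_at:
  "peval (\<lambda>c. poly c t0) l reversed_restriction = DF (p + l *s (t0 *s u + (-1) *s w))"
proof -
  have "(\<lambda>x. peval (\<lambda>c. poly c t0) l [:[:x:]:]) = (\<lambda>x. x)"
    by (rule ext) (simp add: peval_pCons)
  moreover have "(\<chi> i. peval (\<lambda>c. poly c t0) l ((\<chi> i. [:[:p $ i:], [:- w $ i, u $ i:]:]) $ i)) =
      p + l *s (t0 *s u + (-1) *s w)"
    by (simp add: vec_eq_iff peval_pCons algebra_simps)
  ultimately show ?thesis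
    unfolding reversed_restriction_def hom_ev3[OF is_hom_const_poly2 is_hom_peval[OF is_hom_poly]] by simp
qed

lemma restriction_nonzero: "restriction \<noteq> 0"
proof
  assume "restriction = 0"
  hence "DF (s *s p + (0 *s u + (-1) *s w)) = 0" for s
    unfolding restriction_at[symmetric] by simp
  thus False using not_vanishing_along[of 0 "-1"] by auto
qed

lemma reversed_restriction_nonzero: "reversed_restriction \<noteq> 0"
proof
  assume 0: "reversed_restriction = 0"
  obtain s where s: "s \<noteq> 0" "DF (s *s p + (0 *s u + (-1) *s w)) \<noteq> 0"
    using not_vanishing_along[of 0 "-1"] by auto
  have "s *s p + (0 *s u + (-1) *s w) = s *s (p + inverse s *s (0 *s u + (-1) *s w))"
    using s(1) by (simp add: vec_eq_iff field_simps)
  hence "DF (p + inverse s *s (0 *s u + (-1) *s w)) \<noteq> 0" using s(2) by (simp only: DF_scale) simp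
  thus False unfolding reversed_restriction_at[symmetric] 0 by simp
qed

text \<open>
  The form has degree at most \<open>d\<close> on the line, and \<open>p\<close> accounts for \<open>d - r\<close> of the intersections.
\<close>

lemma reversed_restriction_factor:
  "\<exists>q. reversed_restriction = monom 1 (d - r) * q \<and> q \<noteq> 0 \<and> degree q \<le> 4"
proof -
  let ?U = reversed_restriction
  let ?W = "(\<chi> i. [:- w $ i, u $ i:]) :: 'a poly ^ 3"
  have U: "?U = ev3 (\<lambda>c. [:[:c:]:]) (\<chi> i. [:[:p $ i:], ?W $ i:]) D"
    by (simp add: reversed_restriction_def)
  have "coeff ?U n = 0" if "n < d - r" for n
    unfolding U by (rule order_along_line[OF is_hom_const_poly mult that])
  hence "monom 1 (d - r) dvd ?U" by (simp add: monom_1_dvd_iff')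
  then obtain q where q: "?U = monom 1 (d - r) * q" by (elim dvdE)
  have "q \<noteq> 0" using q reversed_restriction_nonzero by auto
  have "degree ?U \<le> d"
    unfolding U by (rule degree_ev3_form[OF form is_hom_const_poly]) simp
  moreover have "degree ?U = (d - r) + degree q"
    unfolding q using \<open>q \<noteq> 0\<close> by (subst degree_mult_eq) (simp_all add: degree_monom_eq)
  ultimately have "degree q \<le> 4" using r by linarith
  thus ?thesis using q \<open>q \<noteq> 0\<close> by blast
qed

text \<open>
  Apart from \<open>s = 0\<close>, the roots are the inverses of roots of a polynomial of degree at most 4 over
  \<open>F(t)\<close>.
\<close>

lemma roots_in_radical_extension:
  assumes root: "peval emb s restriction = 0"
  shows "\<exists>E. radical_extension E \<and> s \<in> E"
proof (cases "s = 0")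
  case True
  thus ?thesis using radical_extension_base is_subfieldD(2)[OF is_subfield_range_to_ac] by metis
next
  case False
  obtain q where q: "reversed_restriction = monom 1 (d - r) * q" "q \<noteq> 0" "degree q \<le> 4"
    using reversed_restriction_factor by blast
  define l where "l = inverse s"
  have l0: "l \<noteq> 0" using False by (simp add: l_def)
  have "const_vec p + l *s (tvar *s const_vec u - const_vec w) = l *s moving_point s"
    using False by (simp add: vec_eq_iff moving_point_def l_def field_simps)
  hence "peval emb l reversed_restriction = 0"
    using root by (simp add: peval_reversed_restriction DK_scale peval_restriction)
  moreover have "peval emb l (monom 1 (d - r)) = l ^ (d - r)"
    by (simp add: peval_def map_poly_monom poly_monom)
  ultimately have "l ^ (d - r) * peval emb l q = 0"
    by (simp add: q(1) is_homD(4)[OF is_hom_peval[OF is_hom_emb]])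
  hence lq: "poly (map_poly emb q) l = 0" using l0 by (simp add: peval_def)
  have "map_poly emb q \<noteq> 0" using q(2) by (simp add: map_poly_eq_0_iff)
  moreover have "degree (map_poly emb q) \<le> 4" using q(3) map_poly_degree_leq order_trans by blast
  moreover have "coeff (map_poly emb q) k \<in> range to_ac" for k by (simp add: coeff_map_poly)
  ultimately obtain E where E: "radical_extension E" "l \<in> E"
    using degree_4_radical[OF radical_extension_base _ _ _ lq] by blast
  have "inverse l \<in> E" by (rule radical_mem(4)[OF E])
  thus ?thesis using E(1) by (auto simp: l_def)
qed

abbreviation LA :: "'a kbar ^ 3 \<Rightarrow> 'a kbar" where "LA \<equiv> linear_form (const_vec a)"
abbreviation LB :: "'a kbar ^ 3 \<Rightarrow> 'a kbar" where "LB \<equiv> linear_form (const_vec b)"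

lemmas dual_K = dual_bases_const_vec[OF dual]
lemmas dual_K_simps = dual_K[unfolded dual_bases_def, THEN conjunct2]

lemma LA_moving_point: "LA (moving_point s) = tvar"
  using dual_K_simps by (simp add: moving_point_def linear_form_linear linear_form_diff)

lemma LB_moving_point: "LB (moving_point s) = - 1"
  using dual_K_simps by (simp add: moving_point_def linear_form_linear linear_form_diff)

lemma moving_point_nonzero: "moving_point s \<noteq> 0"
  using LB_moving_point[of s] by (auto simp: linear_form_0)

text \<open>
  The point is not constant, because \<open>t\<close> is a quotient of two linear forms over \<open>F\<close> in its
  coordinates.
\<close>

lemma square_parametrization_moving_point:
  assumes root: "peval emb s restriction = 0"
  shows "square_parametrization (moving_point s)"
proof -
  obtain E where E: "radical_extension E" "s \<in> E" using roots_in_radical_extension[OF root] by blast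
  obtain Ks where Ks: "root_tower 1 Ks" "last Ks = E" using E(1) by (auto simp: radical_extension_def)
  have base: "to_ac x \<in> E" for x by (rule subsetD[OF radical_extension_base_subset[OF E(1)] rangeI])
  hence "const c \<in> E" "tvar \<in> E" for c by (simp_all add: const_def tvar_def)
  hence "moving_point s $ i \<in> last Ks" for i
    unfolding Ks(2) moving_point_def using E(2) by (auto simp: const_vec_def intro!: radical_mem[OF E(1)])
  moreover have "proj_point (moving_point s) \<notin> proj_space_over (range const)"
  proof
    assume "proj_point (moving_point s) \<in> proj_space_over (range const)"
    then obtain v where v: "\<forall>i. v $ i \<in> range const" "proj_point v = proj_point (moving_point s)"
      by (auto simp: proj_space_over_def)
    obtain c where c: "moving_point s = c *s v" using v(2) by (auto simp: proj_point_eq_iff)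
    define v' where "v' = (\<chi> i. inv_into UNIV const (v $ i))"
    have "const (v' $ i) = v $ i" for i
      using v(1) by (simp add: v'_def f_inv_into_f)
    hence "v = const_vec v'" by (simp add: vec_eq_iff const_vec_def)
    define x y where "x = linear_form a v'" and "y = linear_form b v'"
    have tx: "tvar = c * const x" and cy: "- 1 = c * const y"
      using LA_moving_point[of s] LB_moving_point[of s]
      by (simp_all add: c \<open>v = const_vec v'\<close> linear_form_linear(2) const_vec_linear_form x_def y_def)
    have y0: "y \<noteq> 0" using cy by (auto simp: is_homD[OF is_hom_const])
    \<comment> \<open>The two linear forms take the values \<open>t\<close> and \<open>- 1\<close> at the point, so \<open>t = - x / y\<close>.\<close>
    have "tvar * const y = (c * const y) * const x" by (simp add: tx mult_ac)
    also have "\<dots> = const (- x)" unfolding cy[symmetric] by (simp add: is_hom_uminus[OF is_hom_const])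
    also have "- x = (- x / y) * y" using y0 by simp
    also have "const \<dots> = const (- x / y) * const y" by (rule is_homD(4)[OF is_hom_const])
    finally have "(tvar - const (- x / y)) * const y = 0" by (simp only: left_diff_distrib right_minus_eq)
    hence "tvar = const (- x / y)" using y0 by (simp only: mult_eq_0_iff right_minus_eq const_eq_0_iff) blast
    thus False using tvar_not_const by blast
  qed
  ultimately show ?thesis
    unfolding square_parametrization_def using Ks(1) moving_point_nonzero by blast
qed

text \<open>
  The representatives of the intersection points that are used for the parametrization. This
  normalisation makes all coordinates finite at \<open>t0\<close>, and never all zero, as soon as \<open>s\<close> is finite there.
\<close>

definition branches :: "('a kbar ^ 3) set" where
  "branches = moving_point ` {s. peval emb s restriction = 0}"

lemma finite_branches: "finite branches"
proof -
  have "map_poly emb restriction \<noteq> 0" using restriction_nonzero by (simp add: map_poly_eq_0_iff)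
  hence "finite {s. poly (map_poly emb restriction) s = 0}" by (rule poly_roots_finite)
  thus ?thesis by (simp add: branches_def peval_def)
qed

lemma bij_betw_branches:
  assumes D: "D = defining_form \<Gamma>"
  shows "bij_betw proj_point branches (pencil_intersections \<Gamma> (proj_point p) a b)"
  unfolding bij_betw_def
proof
  show "inj_on proj_point branches"
  proof (rule inj_onI)
    fix v v' assume v: "v \<in> branches" "v' \<in> branches" "proj_point v = proj_point v'"
    obtain c where c: "v' = c *s v" using v(3) by (auto simp: proj_point_eq_iff)
    obtain s s' where "v = moving_point s" "v' = moving_point s'" using v by (auto simp: branches_def)
    hence "- 1 = c * (- 1)" using c LB_moving_point by (metis linear_form_linear(2))
    hence "c = 1" by simp
    thus "v = v'" using c by simp
  qed
  let ?L = "linear_form (const_vec a + tvar *s const_vec b)"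
  have L: "?L v = LA v + tvar * LB v" for v by (simp add: linear_form_linear)
  have zeros: "proj_zeros (map_poly (map_poly (map_poly const)) (defining_form \<Gamma>)) = proj_point ` {v. v \<noteq> 0 \<and> DK v = 0}"
    unfolding proj_zeros_def D[symmetric] eval3_map[OF is_hom_const] ..
  have "Q \<in> pencil_intersections \<Gamma> (proj_point p) a b \<longleftrightarrow> Q \<in> proj_point ` branches" for Q
  proof
    assume Q: "Q \<in> pencil_intersections \<Gamma> (proj_point p) a b"
    then obtain v where v: "Q = proj_point v" "v \<noteq> 0" "DK v = 0"
      unfolding pencil_intersections_def zeros by blast
    obtain v' where v': "Q = proj_point v'" "?L v' = 0"
      using Q unfolding pencil_intersections_def by blast
    have "proj_point v' = proj_point v" using v(1) v'(1) by simp
    then obtain c where "v = c *s v'" unfolding proj_point_eq_iff by blast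
    hence "?L v = 0" using v'(2) by (simp add: linear_form_linear(2))
    hence LAv: "LA v = - (tvar * LB v)" unfolding L by (simp add: eq_neg_iff_add_eq_0)
    define k where "k = linear_form (const_vec e) v"
    have vx: "v = k *s const_vec p + LA v *s const_vec u + LB v *s const_vec w"
      unfolding k_def by (rule dual_bases_expand[OF dual_K])
    have "LB v \<noteq> 0"
    proof
      assume "LB v = 0"
      hence vk: "v = k *s const_vec p" using vx LAv by simp
      hence "k \<noteq> 0" using v(2) by auto
      hence "proj_point (const_vec p) = proj_point v" unfolding proj_point_eq_iff using vk by blast
      hence "Q \<in> (\<lambda>v. proj_point (const_vec v)) ` proj_point p"
        using v(1) self_mem_proj_point[of p] by blast
      thus False using Q unfolding pencil_intersections_def by blast
    qed
    define m where "m = - LB v"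
    have m0: "m \<noteq> 0" using \<open>LB v \<noteq> 0\<close> by (simp add: m_def)
    have vm: "v = m *s moving_point (k / m)"
    proof -
      have "LA v = m * tvar" "LB v = - m" using LAv by (simp_all add: m_def)
      thus ?thesis
        using m0 by (subst vx) (simp add: vec_eq_iff moving_point_def field_simps)
    qed
    hence "DK (moving_point (k / m)) = 0" using v(3) m0 by (simp add: DK_scale)
    hence "moving_point (k / m) \<in> branches" by (auto simp: branches_def peval_restriction)
    moreover have "proj_point (moving_point (k / m)) = Q"
      unfolding v(1) proj_point_eq_iff using vm m0 by blast
    ultimately show "Q \<in> proj_point ` branches" by blast
  next
    assume "Q \<in> proj_point ` branches"
    then obtain s where s: "Q = proj_point (moving_point s)" "DK (moving_point s) = 0"
      by (auto simp: branches_def peval_restriction)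
    have "?L (moving_point s) = 0" unfolding L by (simp add: LA_moving_point LB_moving_point)
    moreover have "Q \<notin> (\<lambda>v. proj_point (const_vec v)) ` proj_point p"
    proof
      assume "Q \<in> (\<lambda>v. proj_point (const_vec v)) ` proj_point p"
      then obtain v where v: "v \<in> proj_point p" "Q = proj_point (const_vec v)" by blast
      obtain c where c: "v = c *s p" using mem_proj_point[OF v(1)] by blast
      have "proj_point (const_vec v) = proj_point (moving_point s)" using v(2) s(1) by simp
      then obtain k where "moving_point s = k *s const_vec v" unfolding proj_point_eq_iff by blast
      hence "- 1 = k * const (linear_form b v)"
        using LB_moving_point[of s] by (simp add: linear_form_linear(2) const_vec_linear_form)
      moreover have "linear_form b v = 0" using dual_simps by (simp add: c linear_form_linear)
      ultimately show False by (simp add: is_homD[OF is_hom_const])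
    qed
    ultimately show "Q \<in> pencil_intersections \<Gamma> (proj_point p) a b"
      unfolding pencil_intersections_def zeros using s moving_point_nonzero by blast
  qed
  thus "proj_point ` branches = pencil_intersections \<Gamma> (proj_point p) a b" by blast
qed

lemma has_value_moving_point:
  assumes place: "place_at t0 V" and s: "has_value V s s0"
  shows "has_value V (moving_point s $ i) ((s0 *s p + (t0 *s u + (-1) *s w)) $ i)"
proof -
  have "has_value V (s * const (p $ i) + (tvar * const (u $ i) + const (-1) * const (w $ i)))
      (s0 * p $ i + (t0 * u $ i + (-1) * w $ i))"
    by (intro has_value_add[OF place] has_value_mult[OF place] s has_value_const[OF place] has_value_tvar[OF place])
  thus ?thesis
    by (simp add: moving_point_def const_vec_def is_hom_uminus[OF is_hom_const] is_homD[OF is_hom_const])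
qed

text \<open>
  The equation of the curve has coefficients in \<open>F\<close>, so it is preserved by places.
\<close>

lemma branch_value_on_curve:
  assumes place: "place_at t0 V" and v: "v \<in> branches" "defined_at V v"
  shows "proj_point (vec_value V v) \<in> proj_zeros D"
proof -
  have "has_value V (v $ i) (vec_value V v $ i)" for i
  proof -
    have "v $ i \<in> V" using v(2) by (simp add: defined_at_def)
    then obtain c where "has_value V (v $ i) c" using place_residue[OF place] by blast
    thus ?thesis using place_value_eqI[OF place] by (simp add: vec_value_def)
  qed
  hence "has_value V (DK v) (DF (vec_value V v))" by (rule has_value_ev3[OF place])
  moreover have "DK v = const 0"
    using v(1) by (auto simp: branches_def peval_restriction is_homD[OF is_hom_const])
  ultimately have "DF (vec_value V v) = 0"
    using has_value_unique[OF place _ has_value_const[OF place]] by metis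
  thus ?thesis using proj_zeros_iff[OF form] v(2) by (auto simp: defined_at_def)
qed

text \<open>
  A point of the curve with \<open>b \<noteq> 0\<close> lies on exactly one line \<open>a + t0 b = 0\<close> of the pencil, and unless the
  leading coefficient of the restriction vanishes at \<open>t0\<close>, it is the value of some branch. The
  finitely many other lines, including \<open>b = 0\<close>, meet the curve in finitely many points.
\<close>

lemma branches_cover:
  assumes places: "\<And>t0. place_at t0 (places t0)"
  shows "finite (proj_zeros D - {proj_point (vec_value (places t0) R) | R t0. R \<in> branches \<and> defined_at (places t0) R})"
proof -
  let ?vals = "{proj_point (vec_value (places t0) R) | R t0. R \<in> branches \<and> defined_at (places t0) R}"
  let ?line = "\<lambda>x y. {proj_point (s *s p + (x *s u + y *s w)) | s. DF (s *s p + (x *s u + y *s w)) = 0}"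
  \<comment> \<open>At these parameters an intersection point of the moving line may have a pole.\<close>
  define bad where "bad = {t0. poly (lead_coeff restriction) t0 = 0}"
  have "finite bad" unfolding bad_def using restriction_nonzero by (intro poly_roots_finite) simp
  hence fin: "finite ({proj_point p} \<union> ?line 1 0 \<union> (\<Union>t0\<in>bad. ?line t0 (-1)))"
    using finite_on_line[of 1 0] finite_on_line[of _ "-1"] by (intro finite_UnI finite_UN_I) auto
  have "Q \<in> {proj_point p} \<union> ?line 1 0 \<union> (\<Union>t0\<in>bad. ?line t0 (-1))"
    if Q: "Q \<in> proj_zeros D" "Q \<notin> ?vals" for Q
  proof -
    obtain v where v: "Q = proj_point v" "v \<noteq> 0" "DF v = 0"
      using Q(1) by (auto simp: proj_zeros_def eval3_eq_ev3)
    define k y z where "k = linear_form e v" and "y = linear_form a v" and "z = linear_form b v"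
    have vx: "v = k *s p + y *s u + z *s w"
      unfolding k_def y_def z_def by (rule dual_bases_expand[OF dual])
    show ?thesis
    proof (cases "z = 0")
      case z: True
      show ?thesis
      proof (cases "y = 0")
        case True
        hence vk: "v = k *s p" using vx z by simp
        hence "k \<noteq> 0" using v(2) by auto
        hence "proj_point p = Q" unfolding v(1) proj_point_eq_iff using vk by blast
        thus ?thesis by blast
      next
        case False
        have vy: "v = y *s ((k / y) *s p + (1 *s u + 0 *s w))"
          using False by (subst vx) (simp add: z vec_eq_iff field_simps)
        hence "DF ((k / y) *s p + (1 *s u + 0 *s w)) = 0" using v(3) False DF_scale by (metis mult_eq_0_iff power_not_zero)
        moreover have "proj_point ((k / y) *s p + (1 *s u + 0 *s w)) = Q"
          unfolding v(1) proj_point_eq_iff using vy False by blast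
        ultimately show ?thesis by blast
      qed
    next
      case False
      define m s0 t0 where "m = - z" and "s0 = k / m" and "t0 = y / m"
      define v' where "v' = s0 *s p + (t0 *s u + (-1) *s w)"
      have m0: "m \<noteq> 0" using False by (simp add: m_def)
      have vm: "v = m *s v'"
        using False by (subst vx) (simp add: v'_def s0_def t0_def m_def vec_eq_iff field_simps)
      have D0: "DF v' = 0" using v(3) m0 unfolding vm DF_scale by simp
      have Q': "Q = proj_point v'" unfolding v(1) using vm m0 proj_point_eq_iff by metis
      have v'0: "v' \<noteq> 0" using vm v(2) by auto
      show ?thesis
      proof (cases "t0 \<in> bad")
        case True
        thus ?thesis using D0 Q' unfolding v'_def by blast
      next
        case nb: False
        have place: "place_at t0 (places t0)" by (rule places)
        obtain s where s: "peval emb s restriction = 0" "has_value (places t0) s s0"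
          using lift_root[OF place, of restriction s0] nb D0
          by (auto simp: bad_def restriction_at v'_def)
        have hv: "has_value (places t0) (moving_point s $ i) (v' $ i)" for i
          unfolding v'_def by (rule has_value_moving_point[OF place s(2)])
        hence vv: "vec_value (places t0) (moving_point s) = v'"
          by (simp add: vec_eq_iff vec_value_def place_value_eqI[OF place])
        have "defined_at (places t0) (moving_point s)"
          unfolding defined_at_def vv using v'0 has_value_mem[OF place hv] by blast
        moreover have "moving_point s \<in> branches" using s(1) by (auto simp: branches_def)
        ultimately have "Q \<in> ?vals" unfolding Q' vv[symmetric] by blast
        thus ?thesis using Q(2) by contradiction
      qed
    qed
  qed
  hence "proj_zeros D - ?vals \<subseteq> {proj_point p} \<union> ?line 1 0 \<union> (\<Union>t0\<in>bad. ?line t0 (-1))"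
    by blast
  thus ?thesis using fin by (rule finite_subset)
qed

end

section \<open>Parametrization by lines\<close>

theorem theorem3p1:
  fixes C :: "('a::{alg_closed_field, field_char_0} \<times> 'a) set"
    and places :: "'a \<Rightarrow> 'a poly fract alg_closure set"
    and P :: "('a ^ 3) set"
    and d r :: nat
  assumes "irreducible_affine_curve C"
    and "\<And>t0. place_at t0 (places t0)"
    and "d = curve_degree (proj_closure C)"
    and "1 \<le> r" and "r \<le> 4" and "r \<le> d"
    and "P \<in> proj_space"
    and "curve_multiplicity (proj_closure C) P = d - r"
  shows "parametrizable_using_lines places (proj_closure C) P"
  unfolding parametrizable_using_lines_def
proof (intro allI impI)
  fix L1 L2 :: "'a ^ 3"
  assume pencil: "is_pencil P L1 L2"
  define D where "D = defining_form (proj_closure C)"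
  note D = defining_form[OF assms(1), folded D_def assms(3)]
  have D0: "D \<noteq> 0" using D(1) by auto
  obtain e p u w where b: "p \<noteq> 0" "P = proj_point p" "dual_bases e L1 L2 p u w"
    using pencil_dual_bases[OF pencil assms(7)] by blast
  note m = curve_multiplicity_props[of "proj_closure C" d, folded D_def, OF D0 D(2)]
  have mult: "curve_multiplicity (proj_closure C) (proj_point p) = d - r"
    using assms(8) b(2) by simp
  interpret curve_with_pencil D d r e L1 L2 p u w
  proof
    show "eval3 (partial_deriv i j k D) p = 0" if "i + j + k < d - r" for i j k
      by (rule m(1)) (simp add: mult that)
    show "eval3 D p \<noteq> 0" if "d = r"
      by (rule m(2)) (simp add: mult that)
  qed (use D b assms in auto)
  have "radical_parametrization places (proj_closure C) branches"
    unfolding radical_parametrization_def D(3)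
    using finite_branches branches_cover[OF assms(2)] branch_value_on_curve[OF assms(2)]
      square_parametrization_moving_point by (auto simp: branches_def)
  moreover have "bij_betw proj_point branches (pencil_intersections (proj_closure C) P L1 L2)"
    unfolding b(2) by (rule bij_betw_branches[OF D_def])
  ultimately show "\<exists>Rs. bij_betw proj_point Rs (pencil_intersections (proj_closure C) P L1 L2) \<and>
      radical_parametrization places (proj_closure C) Rs"
    by blast
qed

end
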